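(* For integers $n$, let $P_n$ and $C_n$ denote the path and the cycle on $n$ vertices, and let $Z_n$ and $W_n$ be the $n$-vertex trees defined in the context. Then: \begin{enumerate} \item $\displaystyle\lim_{n\to\infty}\sigma(C_{2n},Z_{2n})=2$; \item $\displaystyle\lim_{n\to\infty}\sigma(P_n,Z_n)=\frac{8-8\sqrt{2}+2\pi}{\pi}\approx 0.945$; \item $\displaystyle\lim_{n\to\infty}\sigma(W_n,Z_n)=\frac{8-8\sqrt{2}+2\pi}{\pi}\approx 0.945$; \item $\displaystyle\lim_{n\to\infty}\sigma(P_n,Z_n)=\lim_{n\to\infty}\sigma(W_n,Z_n)=\frac{1}{2}\lim_{n\to\infty}\sigma(P_n,W_n)=\frac{8-8\sqrt{2}+2\pi}{\pi}\approx 0.945$. \end{enumerate}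
   Context: All graphs are simple (finite, undirected, no loops or multiple edges); eigenvalues of a graph are those of its adjacency matrix. For two graphs $G_1,G_2$ on $n$ vertices with adjacency eigenvalues $\lambda_1(G_i)\ge\lambda_2(G_i)\ge\cdots\ge\lambda_n(G_i)$ ($i=1,2$), the spectral distance is $\sigma(G_1,G_2)=\sum_{i=1}^n|\lambda_i(G_1)-\lambda_i(G_2)|$. The coalescence of graphs $G$ and $H$ at vertices $u\in V(G)$, $v\in V(H)$ is the graph obtained from the disjoint union of $G$ and $H$ by identifying $u$ with $v$. $Z_n$ denotes the coalescence of $P_{n-2}$ and $P_3$ obtained by identifying one of the degree-1 vertices of $P_{n-2}$ with the degree-2 (middle) vertex of $P_3$ (so $Z_n$ has $n$ vertices). $W_n$ denotes the coalescence of $Z_{n-2}$ and $P_3$ obtained by identifying the degree-1 vertex of $Z_{n-2}$ which is adjacent to a vertex of degree 2 with the degree-2 (middle) vertex of $P_3$ (so $W_n$ has $n$ vertices). *)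

theory Defs
  imports
    Complex_Main
    "HOL-Computational_Algebra.Computational_Algebra"
    "Jordan_Normal_Form.Char_Poly"
    "Graph_Theory.Pair_Digraph"
begin

text \<open>
  A simple graph is a symmetric loop-free pair digraph (locale \<^locale>\<open>pair_graph\<close>):
  the edge \<open>uv\<close> is represented by the two arcs \<open>(u,v)\<close> and \<open>(v,u)\<close>.
\<close>

definition adjacency_mat :: "'a pair_pre_digraph \<Rightarrow> 'a list \<Rightarrow> real mat" where
  "adjacency_mat G vs = mat (length vs) (length vs)
     (\<lambda>(i, j). if (vs ! i, vs ! j) \<in> parcs G then 1 else 0)"

text \<open>
  Which enumeration of the vertices is used is immaterial, see
  \<open>graph_char_poly_eq\<close> below.
\<close>
definition graph_char_poly :: "'a pair_pre_digraph \<Rightarrow> real poly" where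
  "graph_char_poly G =
     char_poly (adjacency_mat G (SOME vs. distinct vs \<and> set vs = pverts G))"

text \<open>
  The eigenvalues with multiplicity in nonincreasing order. The adjacency matrix is
  symmetric, so all its eigenvalues are real, and algebraic and geometric multiplicities
  agree.
\<close>
definition eigenvalue_list :: "'a pair_pre_digraph \<Rightarrow> real list" where
  "eigenvalue_list G = rev (sorted_list_of_multiset (proots (graph_char_poly G)))"

text \<open>The index of \<open>graph_eigenvalue G i\<close> starts at 1.\<close>
definition graph_eigenvalue :: "'a pair_pre_digraph \<Rightarrow> nat \<Rightarrow> real" where
  "graph_eigenvalue G i = eigenvalue_list G ! (i - 1)"

text \<open>Meaningful only for graphs with the same number of vertices.\<close>
definition spectral_distance :: "'a pair_pre_digraph \<Rightarrow> 'b pair_pre_digraph \<Rightarrow> real" where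
  "spectral_distance G H =
     (\<Sum>i = 1..card (pverts G). \<bar>graph_eigenvalue G i - graph_eigenvalue H i\<bar>)"

definition path_graph :: "nat \<Rightarrow> nat pair_pre_digraph" where
  "path_graph n = \<lparr> pverts = {0..<n},
     parcs = {(i, j). i < n \<and> j < n \<and> (j = Suc i \<or> i = Suc j)} \<rparr>"

text \<open>A simple graph only for \<open>n \<noteq> 1\<close>, and a cycle only for \<open>n \<ge> 3\<close>.\<close>
definition cycle_graph :: "nat \<Rightarrow> nat pair_pre_digraph" where
  "cycle_graph n = \<lparr> pverts = {0..<n},
     parcs = {(i, j). i < n \<and> j < n \<and> (j = Suc i mod n \<or> i = Suc j mod n)} \<rparr>"

text \<open>The identified vertex is represented by \<open>Inl u\<close>.\<close>
definition coalescence ::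
  "'a pair_pre_digraph \<Rightarrow> 'a \<Rightarrow> 'b pair_pre_digraph \<Rightarrow> 'b \<Rightarrow> ('a + 'b) pair_pre_digraph"
where
  "coalescence G u H v =
     (let \<iota> = (\<lambda>w. if w = v then Inl u else Inr w)
      in \<lparr> pverts = Inl ` pverts G \<union> \<iota> ` pverts H,
           parcs = map_prod Inl Inl ` parcs G \<union> map_prod \<iota> \<iota> ` parcs H \<rparr>)"

text \<open>
  The path on \<open>n - 2\<close> vertices is attached by its last vertex \<open>n - 3\<close>. Hence its vertex
  \<open>0\<close> remains a leaf of \<open>Z_graph n\<close>; see \<open>Z_graph_end\<close> below.
  The vertex \<open>1\<close> of \<open>path_graph 3\<close> is the middle one.
  Meaningful for \<open>n \<ge> 4\<close>; truncated subtraction makes smaller arguments irrelevant.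
\<close>
definition Z_graph :: "nat \<Rightarrow> (nat + nat) pair_pre_digraph" where
  "Z_graph n = coalescence (path_graph (n - 2)) (n - 3) (path_graph 3) 1"

text \<open>
  Meaningful for \<open>n \<ge> 7\<close>: only then does \<open>Z_graph (n - 2)\<close> have a leaf adjacent to a vertex
  of degree 2.
\<close>
definition W_graph :: "nat \<Rightarrow> ((nat + nat) + nat) pair_pre_digraph" where
  "W_graph n = coalescence (Z_graph (n - 2)) (Inl 0) (path_graph 3) 1"


section \<open>Sanity checks\<close>

lemma graph_char_poly_eq:
  assumes "distinct vs" "set vs = pverts G"
  shows "graph_char_poly G = char_poly (adjacency_mat G vs)"
proof -
  define ws where "ws = (SOME ws. distinct ws \<and> set ws = pverts G)"
  have ws: "distinct ws \<and> set ws = pverts G"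
    unfolding ws_def by (rule someI[of _ vs]) (use assms in simp)
  define n where "n = length vs"
  have len: "length ws = n"
    unfolding n_def using assms ws by (metis distinct_card)
  have bv: "bij_betw ((!) vs) {..<n} (pverts G)"
    using assms bij_betw_nth[of vs "{..<n}" "pverts G"] by (simp add: n_def)
  have bw: "bij_betw ((!) ws) {..<n} (pverts G)"
    using ws len bij_betw_nth[of ws "{..<n}" "pverts G"] by simp
  define f where "f = inv_into {..<n} ((!) vs) \<circ> (!) ws"
  have bf: "bij_betw f {..<n} {..<n}"
    unfolding f_def using bij_betw_trans[OF bw bij_betw_inv_into[OF bv]] .
  have fv: "vs ! f i = ws ! i" if "i < n" for i
    unfolding f_def using bij_betw_inv_into_right[OF bv] bij_betwE[OF bw] that by simp
  have fn: "f i < n" if "i < n" for i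
    using bij_betwE[OF bf] that by simp
  have finj: "f i = f j \<longleftrightarrow> i = j" if "i < n" "j < n" for i j
    using bij_betw_imp_inj_on[OF bf] that by (auto simp: inj_on_def)
  define P where "P = mat n n (\<lambda>(i, j). if f i = j then 1 else (0 :: real))"
  define Q where "Q = mat n n (\<lambda>(i, j). if i = f j then 1 else (0 :: real))"
  have A: "adjacency_mat G vs \<in> carrier_mat n n" and B: "adjacency_mat G ws \<in> carrier_mat n n"
    by (simp_all add: adjacency_mat_def n_def len[unfolded n_def])
  have PQc: "P \<in> carrier_mat n n" "Q \<in> carrier_mat n n"
    by (simp_all add: P_def Q_def)
  have PA: "(P * M) $$ (i, j) = M $$ (f i, j)"
    if "M \<in> carrier_mat n n" "i < n" "j < n" for M i j
    using that fn[of i] 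
    by (simp add: P_def scalar_prod_def if_distrib[of "\<lambda>x. x * _"] sum.delta cong: if_cong)
  have MQ: "(M * Q) $$ (i, j) = M $$ (i, f j)"
    if "M \<in> carrier_mat n n" "i < n" "j < n" for M i j
    using that fn[of j]
    by (simp add: Q_def scalar_prod_def if_distrib[of "\<lambda>x. _ * x"] sum.delta cong: if_cong)
  have PQ: "P * Q = 1\<^sub>m n"
    by (rule eq_matI) (use PQc in \<open>auto simp: PA finj fn Q_def simp del: index_mult_mat(1)\<close>)
  have QP: "Q * P = 1\<^sub>m n"
    using mat_mult_left_right_inverse[OF PQc PQ] .
  have BA: "adjacency_mat G ws = P * adjacency_mat G vs * Q"
  proof (rule eq_matI)
    fix i j assume "i < dim_row (P * adjacency_mat G vs * Q)"
      "j < dim_col (P * adjacency_mat G vs * Q)"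
    hence ij: "i < n" "j < n" using PQc by auto
    have "(P * adjacency_mat G vs * Q) $$ (i, j) = adjacency_mat G vs $$ (f i, f j)"
      using ij A PQc fn by (simp add: MQ PA del: index_mult_mat(1))
    also have "\<dots> = adjacency_mat G ws $$ (i, j)"
      using ij fn[OF ij(1)] fn[OF ij(2)] len n_def by (simp add: adjacency_mat_def fv)
    finally show "adjacency_mat G ws $$ (i, j) = (P * adjacency_mat G vs * Q) $$ (i, j)" ..
  qed (use A B PQc in auto)
  have "similar_mat (adjacency_mat G ws) (adjacency_mat G vs)"
    by (rule similar_matI[OF _ PQ QP BA]) (use A B PQc in auto)
  hence "char_poly (adjacency_mat G ws) = char_poly (adjacency_mat G vs)"
    by (rule char_poly_similar)
  thus ?thesis by (simp add: graph_char_poly_def ws_def)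
qed

lemma pair_graph_path_graph: "pair_graph (path_graph n)"
  by unfold_locales
     (auto simp: path_graph_def symmetric_def sym_def arcs_ends_conv
           intro: finite_subset[of _ "{..<n} \<times> {..<n}"])

lemma pair_graph_cycle_graph:
  assumes "n \<noteq> 1"
  shows "pair_graph (cycle_graph n)"
  using assms
  by unfold_locales
     (auto simp: cycle_graph_def symmetric_def sym_def arcs_ends_conv mod_Suc split: if_splits
           intro: finite_subset[of _ "{..<n} \<times> {..<n}"])

lemma pair_graph_coalescence:
  assumes "pair_graph G" "pair_graph H" "u \<in> pverts G" "v \<in> pverts H"
  shows "pair_graph (coalescence G u H v)"
proof -
  interpret G: pair_graph G by fact
  interpret H: pair_graph H by fact
  define \<iota> :: "'b \<Rightarrow> 'a + 'b" where "\<iota> = (\<lambda>w. if w = v then Inl u else Inr w)"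
  have V: "pverts (coalescence G u H v) = Inl ` pverts G \<union> \<iota> ` pverts H"
    and E: "parcs (coalescence G u H v) =
      map_prod Inl Inl ` parcs G \<union> map_prod \<iota> \<iota> ` parcs H"
    by (simp_all add: coalescence_def Let_def \<iota>_def)
  have "inj \<iota>" by (auto simp: \<iota>_def inj_def)
  have symG: "sym (parcs G)" and symH: "sym (parcs H)"
    using G.pair_sym_arcs H.pair_sym_arcs by (simp_all add: symmetric_def)
  show ?thesis
  proof
    show "symmetric (with_proj (coalescence G u H v))"
      unfolding symmetric_def with_proj_simps E
    proof (rule symI)
      fix x y
      assume "(x, y) \<in> map_prod Inl Inl ` parcs G \<union> map_prod \<iota> \<iota> ` parcs H"
      then consider a b where "(a, b) \<in> parcs G" "x = Inl a" "y = Inl b"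
        | a b where "(a, b) \<in> parcs H" "x = \<iota> a" "y = \<iota> b"
        by auto
      thus "(y, x) \<in> map_prod Inl Inl ` parcs G \<union> map_prod \<iota> \<iota> ` parcs H"
        by cases (use symD[OF symG] symD[OF symH] in blast)+
    qed
  next
    fix e assume "e \<in> parcs (coalescence G u H v)"
    then consider a b where "(a, b) \<in> parcs G" "e = (Inl a, Inl b)"
        | a b where "(a, b) \<in> parcs H" "e = (\<iota> a, \<iota> b)"
        unfolding E by auto
    thus "fst e \<in> pverts (coalescence G u H v)" "snd e \<in> pverts (coalescence G u H v)"
        "fst e \<noteq> snd e"
      by (cases; use G.in_arcsD1 G.in_arcsD2 H.in_arcsD1 H.in_arcsD2 G.pair_no_loops
           H.pair_no_loops \<open>inj \<iota>\<close> in \<open>force simp: V inj_eq\<close>)+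
  qed (simp_all add: V E G.pair_finite_verts H.pair_finite_verts G.pair_finite_arcs
         H.pair_finite_arcs)
qed

lemma card_pverts_coalescence:
  assumes "finite (pverts G)" "finite (pverts H)" "u \<in> pverts G" "v \<in> pverts H"
  shows "card (pverts (coalescence G u H v)) = card (pverts G) + card (pverts H) - 1"
proof -
  have eq: "pverts (coalescence G u H v) = Inl ` pverts G \<union> Inr ` (pverts H - {v})"
    using assms by (auto simp: coalescence_def Let_def)
  have "card (pverts H) > 0" using assms by (auto simp: card_gt_0_iff)
  thus ?thesis unfolding eq using assms
    by (subst card_Un_disjoint) (auto simp: card_image)
qed

lemma Z_graph_simple:
  assumes "n \<ge> 3"
  shows "pair_graph (Z_graph n)" "card (pverts (Z_graph n)) = n"
  unfolding Z_graph_def using assms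
  by (auto intro!: pair_graph_coalescence pair_graph_path_graph simp: card_pverts_coalescence)
     (auto simp: path_graph_def card_pverts_coalescence)

lemma W_graph_simple:
  assumes "n \<ge> 5"
  shows "pair_graph (W_graph n)" "card (pverts (W_graph n)) = n"
proof -
  have "Inl 0 \<in> pverts (Z_graph (n - 2))"
    using assms by (auto simp: Z_graph_def coalescence_def path_graph_def Let_def)
  thus "pair_graph (W_graph n)" "card (pverts (W_graph n)) = n"
    unfolding W_graph_def using assms Z_graph_simple[of "n - 2"]
    by (auto intro!: pair_graph_coalescence pair_graph_path_graph)
       (auto simp: path_graph_def card_pverts_coalescence pair_graph_def pair_digraph_def
         pair_fin_digraph_def pair_fin_digraph_axioms_def card_gt_0_iff intro!: card_ge_0_finite)
qed

lemma parcs_Z_graph: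
  "parcs (Z_graph (m + 5)) =
     {(Inl i, Inl j) | i j. i < m + 3 \<and> j < m + 3 \<and> (j = Suc i \<or> i = Suc j)} \<union>
     {(Inl (m + 2), Inr 0), (Inl (m + 2), Inr 2), (Inr 0, Inl (m + 2)), (Inr 2, Inl (m + 2))}"
proof -
  have "parcs (path_graph 3) = {(0, 1), (1, 0), (1, 2), (2, 1)}"
    by (auto simp: path_graph_def)
  moreover have "parcs (path_graph (m + 3)) =
      {(i, j) | i j. i < m + 3 \<and> j < m + 3 \<and> (j = Suc i \<or> i = Suc j)}"
    by (auto simp: path_graph_def)
  ultimately show ?thesis
    by (auto simp: Z_graph_def coalescence_def Let_def image_iff numeral_eq_Suc)
qed

lemma out_degree_Z_graph:
  "out_degree (Z_graph (m + 5)) w = (case w of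
     Inl i \<Rightarrow> if i = 0 then 1 else if i < m + 2 then 2 else if i = m + 2 then 3 else 0
   | Inr j \<Rightarrow> if j = 0 \<or> j = 2 then 1 else 0)"
proof -
  define S :: "(nat + nat) set" where "S = (case w of
     Inl i \<Rightarrow> if i = 0 then {Inl 1} else if i < m + 2 then {Inl (i - 1), Inl (i + 1)}
              else if i = m + 2 then {Inl (m + 1), Inr 0, Inr 2} else {}
   | Inr j \<Rightarrow> if j = 0 \<or> j = 2 then {Inl (m + 2)} else {})"
  have "out_arcs (Z_graph (m + 5)) w = Pair w ` S"
    unfolding S_def out_arcs_def with_proj_simps parcs_Z_graph
    by (cases w) (auto split: if_splits)
  thus ?thesis
    unfolding out_degree_def by (auto simp: card_image S_def inj_on_def split: sum.splits)
qed

text \<open>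
  In \<open>Z_graph n\<close> the vertex \<open>Inl 0\<close> is the unique vertex of degree 1 that is adjacent to a
  vertex of degree 2.
\<close>
lemma Z_graph_end:
  assumes "n \<ge> 5"
  shows "out_degree (Z_graph n) w = 1 \<and>
           (\<exists>w'. (w, w') \<in> parcs (Z_graph n) \<and> out_degree (Z_graph n) w' = 2) \<longleftrightarrow> w = Inl 0"
proof -
  obtain m where n: "n = m + 5" using assms by (metis add.commute le_Suc_ex)
  show ?thesis unfolding n out_degree_Z_graph parcs_Z_graph
    by (cases w) (auto split: if_splits sum.splits)
qed

end

(*
All four spectra are explicit. Deleting a pendant vertex gives the Chebyshev recurrence for the
characteristic polynomials of the trees, so that with x = 2 cos t they are sin((n+1)t)/sin t for
P_n, 2x cos((n-1)t) for Z_n and 2x^2 (cos((n-2)t) - cos((n-4)t)) for W_n; the cycle is diagonalised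
by the discrete Fourier transform. Each of these spectra is symmetric for the graphs compared here,
and apart from one zero eigenvalue of W_n the k-th eigenvalue in the upper half has the form
2 cos(pi (k+c)/(n+d)). For k = x n two such sequences differ by
2 pi sin(pi x) |(c-c') - (d-d') x| / n + O(1/n^2) in absolute value, so the spectral distance is
asymptotically a Riemann sum of twice this density over [0, 1/2]. The eigenvalues of the cycle come
in pairs, so there even and odd indices are treated separately.
*)
theory Submission
  imports
    "HOL-Analysis.Lipschitz"
    "HOL-Analysis.Henstock_Kurzweil_Integration"
    "HOL-Analysis.Complex_Transcendental"
    Defs
begin

section \<open>Characteristic polynomials\<close>

text \<open>The asymptotics see the trees only through (c, d), which is (0, 1) for P, (-1/2, -1) for
  Z and (-1, -3) for W. The pair of Z is the exact midpoint of the other two, so its distances to P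
  and to W have the same density and the distance between P and W has twice that density: this is
  the reason for the factor 1/2. The common linear factor 1/2 - 2 x changes sign at x = 1/4, inside
  the range of integration, and the sine of pi/4 is the source of the square root of 2. For the
  cycle there is no sign change and the terms in 1/pi cancel. Characteristic polynomials are
  attached to vertex lists that may omit vertices, so deleting a vertex means dropping a list entry
  and no subgraph has to be built. Since eigenvalues are compared in sorted order, zero eigenvalues
  must be placed correctly: those of Z agree with its cosine formula, whereas for W with even n the
  formula is slightly negative at index n div 2, where it is overwritten by 0 at negligible
  cost.\<close>

abbreviation list_char_poly :: "'a pair_pre_digraph \<Rightarrow> 'a list \<Rightarrow> real poly" where
  "list_char_poly G vs \<equiv> char_poly (adjacency_mat G vs)"

section \<open>Deleting isolated and pendant vertices\<close>

lemma adjacency_mat_carrier: "adjacency_mat G vs \<in> carrier_mat (length vs) (length vs)"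
  by (simp add: adjacency_mat_def)

lemma list_char_poly_Nil: "list_char_poly G [] = 1"
  by (simp add: char_poly_def char_poly_matrix_def adjacency_mat_def)

lemma char_poly_matrix_adjacency:
  assumes "i < length vs" "j < length vs"
  shows "char_poly_matrix (adjacency_mat G vs) $$ (i, j) =
    (if i = j then [:0, 1:] else 0) - (if (vs ! i, vs ! j) \<in> parcs G then 1 else 0)"
  using assms by (simp add: char_poly_matrix_def adjacency_mat_def one_pCons)

lemma mat_delete_char_poly_matrix_adjacency:
  "mat_delete (char_poly_matrix (adjacency_mat G (v # vs))) 0 0 =
     char_poly_matrix (adjacency_mat G vs)"
  by (rule eq_matI)
     (simp_all add: mat_delete_def char_poly_matrix_def adjacency_mat_def)

lemma list_char_poly_isolated:
  assumes "(v, v) \<notin> parcs G" "\<And>w. w \<in> set ws \<Longrightarrow> (v, w) \<notin> parcs G"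
  shows "list_char_poly G (v # ws) = [:0, 1:] * list_char_poly G ws"
proof -
  let ?M = "char_poly_matrix (adjacency_mat G (v # ws))"
  let ?n = "length ws"
  have M: "?M \<in> carrier_mat (Suc ?n) (Suc ?n)"
    using adjacency_mat_carrier[of G "v # ws"] by simp
  have "det ?M = (\<Sum>j<Suc ?n. ?M $$ (0, j) * cofactor ?M 0 j)"
    by (rule laplace_expansion_row[OF M]) simp
  also have "\<dots> = ?M $$ (0, 0) * cofactor ?M 0 0 + (\<Sum>j<?n. ?M $$ (0, Suc j) * cofactor ?M 0 (Suc j))"
    by (rule sum.lessThan_Suc_shift)
  also have "(\<Sum>j<?n. ?M $$ (0, Suc j) * cofactor ?M 0 (Suc j)) = 0"
    using assms(2) by (intro sum.neutral) (simp add: char_poly_matrix_adjacency)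
  also have "?M $$ (0, 0) = [:0, 1:]"
    using assms(1) by (simp add: char_poly_matrix_adjacency)
  finally show ?thesis
    by (simp add: char_poly_def cofactor_def mat_delete_char_poly_matrix_adjacency)
qed

text \<open>Row v of the characteristic matrix has only its diagonal entry and the entry -1 at u. In
  the minor of the latter the column of v again has a single entry -1, in row u, so a second
  expansion leaves the matrix of \<open>ws\<close>.\<close>

lemma list_char_poly_pendant:
  assumes "(v, v) \<notin> parcs G" "(v, u) \<in> parcs G" "(u, v) \<in> parcs G" "u \<noteq> v"
    "\<And>w. w \<in> set ws \<Longrightarrow> (v, w) \<notin> parcs G \<and> (w, v) \<notin> parcs G"
  shows "list_char_poly G (v # u # ws) =
    [:0, 1:] * list_char_poly G (u # ws) - list_char_poly G ws"
proof -
  let ?M = "char_poly_matrix (adjacency_mat G (v # u # ws))"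
  let ?n = "length ws"
  have M: "?M \<in> carrier_mat (Suc (Suc ?n)) (Suc (Suc ?n))"
    using adjacency_mat_carrier[of G "v # u # ws"] by simp
  define N where "N = mat_delete ?M 0 1"
  have N: "N \<in> carrier_mat (Suc ?n) (Suc ?n)"
    using mat_delete_carrier[OF M] by (simp add: N_def)
  have "det N = (\<Sum>i<Suc ?n. N $$ (i, 0) * cofactor N i 0)"
    by (rule laplace_expansion_column[OF N]) simp
  also have "\<dots> = N $$ (0, 0) * cofactor N 0 0 + (\<Sum>i<?n. N $$ (Suc i, 0) * cofactor N (Suc i) 0)"
    by (rule sum.lessThan_Suc_shift)
  also have "(\<Sum>i<?n. N $$ (Suc i, 0) * cofactor N (Suc i) 0) = 0"
    using assms(5) M
    by (intro sum.neutral) (auto simp: N_def mat_delete_def char_poly_matrix_adjacency)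
  also have "N $$ (0, 0) = -1"
    using assms(3,4) M by (auto simp: N_def mat_delete_def char_poly_matrix_adjacency)
  also have "mat_delete N 0 0 = char_poly_matrix (adjacency_mat G ws)"
    by (rule eq_matI)
       (simp_all add: N_def mat_delete_def char_poly_matrix_def adjacency_mat_def)
  hence "cofactor N 0 0 = list_char_poly G ws"
    by (simp add: cofactor_def char_poly_def)
  finally have detN: "det N = - list_char_poly G ws" by simp
  have "det ?M = (\<Sum>j<Suc (Suc ?n). ?M $$ (0, j) * cofactor ?M 0 j)"
    by (rule laplace_expansion_row[OF M]) simp
  also have "\<dots> = ?M $$ (0, 0) * cofactor ?M 0 0 + (?M $$ (0, 1) * cofactor ?M 0 1 +
      (\<Sum>j<?n. ?M $$ (0, Suc (Suc j)) * cofactor ?M 0 (Suc (Suc j))))"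
    by (simp only: sum.lessThan_Suc_shift One_nat_def)
  also have "(\<Sum>j<?n. ?M $$ (0, Suc (Suc j)) * cofactor ?M 0 (Suc (Suc j))) = 0"
    using assms(5) by (intro sum.neutral) (simp add: char_poly_matrix_adjacency)
  also have "?M $$ (0, 0) = [:0, 1:]"
    using assms(1) by (simp add: char_poly_matrix_adjacency)
  also have "?M $$ (0, 1) = -1"
    using assms(2,4) by (simp add: char_poly_matrix_adjacency)
  also have "cofactor ?M 0 0 = list_char_poly G (u # ws)"
    by (simp add: char_poly_def cofactor_def mat_delete_char_poly_matrix_adjacency)
  also have "cofactor ?M 0 1 = list_char_poly G ws"
    using detN by (simp add: cofactor_def N_def)
  finally show ?thesis
    by (simp add: char_poly_def)
qed

lemma list_char_poly_perm:
  assumes "distinct vs" "distinct ws" "set vs = set ws"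
  shows "list_char_poly G vs = list_char_poly G ws"
proof -
  \<comment> \<open>The matrix ignores \<open>pverts\<close>, so the listed vertices may be declared
    to be the vertex set; \<open>graph_char_poly_eq\<close> then also covers lists that omit
    vertices.\<close>
  let ?H = "\<lparr>pverts = set ws, parcs = parcs G\<rparr>"
  have "list_char_poly G xs = list_char_poly ?H xs" for xs
    by (simp add: adjacency_mat_def)
  thus ?thesis
    using graph_char_poly_eq[of vs ?H] graph_char_poly_eq[of ws ?H] assms by simp
qed

section \<open>Three-term recurrence and Chebyshev polynomials\<close>

text \<open>The recurrence of leaf deletion along a path, with free starting values. From 1 and x it
  yields the Chebyshev polynomials of the second kind at x/2, from x and x^2 - 2 twice those of the
  first kind, with the index shifted by one.\<close>

fun chain_poly :: "real poly \<Rightarrow> real poly \<Rightarrow> nat \<Rightarrow> real poly" where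
  "chain_poly a b 0 = a"
| "chain_poly a b (Suc 0) = b"
| "chain_poly a b (Suc (Suc n)) = [:0, 1:] * chain_poly a b (Suc n) - chain_poly a b n"

text \<open>Both claims go through one induction: the degree of the product with x is read off from
  a nonzero predecessor, and the subtracted polynomial has smaller degree.\<close>

lemma
  assumes "degree a = d" "degree b = Suc d" "lead_coeff a = 1" "lead_coeff b = 1"
  shows degree_chain_poly: "degree (chain_poly a b n) = d + n"
    and chain_poly_nonzero: "chain_poly a b n \<noteq> 0"
proof -
  have "degree (chain_poly a b n) = d + n \<and> chain_poly a b n \<noteq> 0"
  proof (induction n rule: induct_nat_012)
    case (ge2 n)
    let ?p = "[:0, 1:] * chain_poly a b (Suc n)" and ?q = "- chain_poly a b n"
    have deg: "degree ?p = Suc (Suc (d + n))"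
      using ge2(2) degree_mult_eq[of "[:0, 1:]" "chain_poly a b (Suc n)"] by simp
    hence "degree ?q < degree ?p"
      using ge2 by simp
    moreover have "chain_poly a b (Suc (Suc n)) = ?p + ?q"
      by simp
    ultimately have "degree (chain_poly a b (Suc (Suc n))) = Suc (Suc (d + n))"
      using deg by (simp only: degree_add_eq_left)
    thus ?case by auto
  qed (use assms in auto)
  thus "degree (chain_poly a b n) = d + n" "chain_poly a b n \<noteq> 0" by auto
qed

text \<open>The product form avoids dividing by sin t; roots are later taken at angles where sin t
  is positive.\<close>

lemma poly_chain_poly_sin:
  "sin t * poly (chain_poly 1 [:0, 1:] n) (2 * cos t) = sin (real (n + 1) * t)"
proof (induction n rule: induct_nat_012)
  case 1
  show ?case using sin_double[of t] by simp
next
  case (ge2 n)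
  have "sin (real (n + 2) * t + t) + sin (real (n + 2) * t - t) = 2 * cos t * sin (real (n + 2) * t)"
    unfolding sin_add sin_diff by simp
  thus ?case using ge2 by (simp add: algebra_simps)
qed simp

lemma poly_chain_poly_cos:
  "poly (chain_poly [:0, 1:] [:-2, 0, 1:] n) (2 * cos t) = 2 * cos (real (n + 1) * t)"
proof (induction n rule: induct_nat_012)
  case 1
  show ?case using cos_double_cos[of t] by (simp add: power2_eq_square)
next
  case (ge2 n)
  have "cos (real (n + 2) * t + t) + cos (real (n + 2) * t - t) = 2 * cos t * cos (real (n + 2) * t)"
    unfolding cos_add cos_diff by simp
  thus ?case using ge2 by (simp add: algebra_simps)
qed simp

section \<open>Characteristic polynomials of the trees\<close>

lemma graph_char_poly_path:
  "graph_char_poly (path_graph n) = chain_poly 1 [:0, 1:] n"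
proof -
  \<comment> \<open>The induction runs over final segments of the path, in which the first vertex is
    a leaf attached to the second.\<close>
  have "list_char_poly (path_graph n) [n - k..<n] = chain_poly 1 [:0, 1:] k" if "k \<le> n" for k
    using that
  proof (induction k rule: induct_nat_012)
    case 1
    hence "[n - Suc 0..<n] = [n - 1]"
      using upt_conv_Cons[of "n - 1" n] by simp
    thus ?case
      using list_char_poly_isolated[of "n - 1" "path_graph n" "[]"]
      by (simp add: list_char_poly_Nil path_graph_def)
  next
    case (ge2 k)
    let ?a = "n - Suc (Suc k)"
    have "[?a..<n] = ?a # Suc ?a # [Suc (Suc ?a)..<n]" and e: "Suc (Suc ?a) = n - k"
        "[n - Suc k..<n] = Suc ?a # [Suc (Suc ?a)..<n]"
      using ge2.prems by (simp_all add: upt_conv_Cons Suc_diff_Suc)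
    moreover have "list_char_poly (path_graph n) (?a # Suc ?a # [Suc (Suc ?a)..<n]) =
      [:0, 1:] * list_char_poly (path_graph n) (Suc ?a # [Suc (Suc ?a)..<n]) -
        list_char_poly (path_graph n) [Suc (Suc ?a)..<n]"
      by (rule list_char_poly_pendant) (use ge2.prems in \<open>auto simp: path_graph_def\<close>)
    ultimately show ?case
      using ge2 by simp
  qed (simp_all add: list_char_poly_Nil)
  from this[of n] show ?thesis
    using graph_char_poly_eq[of "[0..<n]" "path_graph n"] by (auto simp: path_graph_def)
qed

lemma card_pverts_graph: "card (pverts (path_graph n)) = n" "card (pverts (cycle_graph n)) = n"
  by (simp_all add: path_graph_def cycle_graph_def)

lemma parcs_Z_graph_eq:
  assumes "n \<ge> 3"
  shows "parcs (Z_graph n) =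
     {(Inl i, Inl j) | i j. i < n - 2 \<and> j < n - 2 \<and> (j = Suc i \<or> i = Suc j)} \<union>
     {(Inl (n - 3), Inr 0), (Inl (n - 3), Inr 2), (Inr 0, Inl (n - 3)), (Inr 2, Inl (n - 3))}"
proof -
  have "parcs (path_graph 3) = {(0, 1), (1, 0), (1, 2), (2, 1)}"
    by (auto simp: path_graph_def)
  thus ?thesis
    by (auto simp: Z_graph_def coalescence_def Let_def image_iff path_graph_def)
qed

lemma pverts_Z_graph: "n \<ge> 3 \<Longrightarrow> pverts (Z_graph n) = Inl ` {..<n - 2} \<union> {Inr 0, Inr 2}"
  by (auto simp: Z_graph_def coalescence_def Let_def path_graph_def image_iff numeral_3_eq_3 less_Suc_eq)

text \<open>A path with two leaves a, b at its last vertex, of which only the last k path vertices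
  are kept. The start values are two isolated leaves, x^2, and a path on three vertices, x (x^2 -
  2); the factor x is common. The abstract embedding f serves \<open>Z_graph\<close> and two
  different pieces of \<open>W_graph\<close>.\<close>

lemma list_char_poly_fork:
  fixes G :: "'a pair_pre_digraph" and f :: "nat \<Rightarrow> 'a"
  assumes "m \<ge> 1"
    and arcs: "\<And>i j. i < m \<Longrightarrow> j < m \<Longrightarrow> (f i, f j) \<in> parcs G \<longleftrightarrow> j = Suc i \<or> i = Suc j"
    and leaf: "\<And>i v. i < m \<Longrightarrow> v \<in> {a, b} \<Longrightarrow> ((f i, v) \<in> parcs G \<longleftrightarrow> i = m - 1) \<and> ((v, f i) \<in> parcs G \<longleftrightarrow> i = m - 1)"
    and ab: "(a, a) \<notin> parcs G" "(a, b) \<notin> parcs G" "(b, a) \<notin> parcs G" "(b, b) \<notin> parcs G"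
    and dist: "distinct (map f [0..<m] @ [a, b])"
    and "k \<le> m"
  shows "list_char_poly G (map f [m - k..<m] @ [a, b]) =
    [:0, 1:] * chain_poly [:0, 1:] [:-2, 0, 1:] k"
  using \<open>k \<le> m\<close>
proof (induction k rule: induct_nat_012)
  case 0
  show ?case
    using list_char_poly_isolated[of a G "[b]"] list_char_poly_isolated[of b G "[]"] ab
    by (simp add: list_char_poly_Nil)
next
  case 1
  let ?u = "f (m - 1)"
  have u: "?u \<noteq> a" "?u \<noteq> b" "a \<noteq> b"
    using dist \<open>m \<ge> 1\<close> by (auto simp: image_iff)
  have uu: "(?u, ?u) \<notin> parcs G" "(?u, a) \<in> parcs G" "(a, ?u) \<in> parcs G" "(?u, b) \<in> parcs G" "(b, ?u) \<in> parcs G"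
    using \<open>m \<ge> 1\<close> arcs[of "m - 1" "m - 1"] leaf[of "m - 1" a] leaf[of "m - 1" b] by auto
  have "map f [m - Suc 0..<m] @ [a, b] = [?u, a, b]"
    using \<open>m \<ge> 1\<close> upt_conv_Cons[of "m - 1" m] by simp
  also have "list_char_poly G [?u, a, b] = list_char_poly G [a, ?u, b]"
    by (rule list_char_poly_perm) (use u in auto)
  also have "\<dots> = [:0, 1:] * list_char_poly G [?u, b] - list_char_poly G [b]"
    by (rule list_char_poly_pendant) (use ab u uu in auto)
  also have "list_char_poly G [?u, b] = list_char_poly G [b, ?u]"
    by (rule list_char_poly_perm) (use u in auto)
  also have "\<dots> = [:0, 1:] * list_char_poly G [?u] - list_char_poly G []"
    by (rule list_char_poly_pendant) (use ab u uu in auto)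
  also have "list_char_poly G [?u] = [:0, 1:]"
    using list_char_poly_isolated[of ?u G "[]"] uu by (simp add: list_char_poly_Nil)
  also have "list_char_poly G [b] = [:0, 1:]"
    using list_char_poly_isolated[of b G "[]"] ab by (simp add: list_char_poly_Nil)
  finally show ?case
    by (simp add: list_char_poly_Nil one_pCons)
next
  case (ge2 k)
  let ?a = "m - Suc (Suc k)"
  let ?ws = "map f [Suc (Suc ?a)..<m] @ [a, b]"
  have "[?a..<m] = ?a # Suc ?a # [Suc (Suc ?a)..<m]" and e: "Suc (Suc ?a) = m - k"
      "[m - Suc k..<m] = Suc ?a # [Suc (Suc ?a)..<m]"
    using ge2.prems by (simp_all add: upt_conv_Cons Suc_diff_Suc)
  moreover have "list_char_poly G (f ?a # f (Suc ?a) # ?ws) =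
    [:0, 1:] * list_char_poly G (f (Suc ?a) # ?ws) - list_char_poly G ?ws"
  proof (rule list_char_poly_pendant)
    have "Suc ?a < m"
      using ge2.prems by linarith
    thus "f (Suc ?a) \<noteq> f ?a"
      using dist inj_onD[of f "{0..<m}" "Suc ?a" ?a] by (auto simp: distinct_map)
  qed (use ge2.prems arcs leaf in auto)
  ultimately show ?case
    using ge2 by (simp add: algebra_simps)
qed

lemma graph_char_poly_Z:
  assumes "n \<ge> 3"
  shows "graph_char_poly (Z_graph n) = [:0, 1:] * chain_poly [:0, 1:] [:-2, 0, 1:] (n - 2)"
proof -
  let ?vs = "map Inl [0..<n - 2] @ [Inr 0, Inr 2] :: (nat + nat) list"
  have "distinct ?vs" "set ?vs = pverts (Z_graph n)"
    using assms by (auto simp: pverts_Z_graph distinct_map)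
  hence "graph_char_poly (Z_graph n) = list_char_poly (Z_graph n) ?vs"
    by (rule graph_char_poly_eq)
  also have "list_char_poly (Z_graph n) (map Inl [(n - 2) - (n - 2)..<n - 2] @ [Inr 0, Inr 2]) =
    [:0, 1:] * chain_poly [:0, 1:] [:-2, 0, 1:] (n - 2)"
    by (rule list_char_poly_fork) (use assms in \<open>auto simp: parcs_Z_graph_eq distinct_map\<close>)
  hence "list_char_poly (Z_graph n) ?vs = [:0, 1:] * chain_poly [:0, 1:] [:-2, 0, 1:] (n - 2)"
    by simp
  finally show ?thesis .
qed

lemma parcs_W_graph:
  assumes "n \<ge> 5"
  shows "parcs (W_graph n) = map_prod Inl Inl ` parcs (Z_graph (n - 2)) \<union>
     {(Inl (Inl 0), Inr 0), (Inl (Inl 0), Inr 2), (Inr 0, Inl (Inl 0)), (Inr 2, Inl (Inl 0))}"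
proof -
  have "parcs (path_graph 3) = {(0, 1), (1, 0), (1, 2), (2, 1)}"
    by (auto simp: path_graph_def)
  thus ?thesis
    by (auto simp: W_graph_def coalescence_def Let_def)
qed

lemma pverts_W_graph:
  assumes "n \<ge> 5"
  shows "pverts (W_graph n) = Inl ` pverts (Z_graph (n - 2)) \<union> {Inr 0, Inr 2}"
proof -
  have "pverts (path_graph 3) = {0, 1, 2}"
    by (auto simp: path_graph_def)
  thus ?thesis
    using assms by (auto simp: W_graph_def coalescence_def Let_def pverts_Z_graph)
qed

text \<open>Deleting the leaf \<open>Inr 0\<close> leaves a fork whose path starts at
  \<open>Inr 2\<close>. Deleting its neighbour as well isolates \<open>Inr 2\<close> and leaves a
  fork with two path vertices fewer. Each term has one factor x from the fork and one from the
  deletion or the isolated vertex.\<close>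

lemma graph_char_poly_W:
  assumes "n \<ge> 6"
  shows "graph_char_poly (W_graph n) = [:0, 1:] ^ 2 *
    (chain_poly [:0, 1:] [:-2, 0, 1:] (n - 3) - chain_poly [:0, 1:] [:-2, 0, 1:] (n - 5))"
proof -
  let ?G = "W_graph n" and ?X = "[:0, 1:] :: real poly"
  let ?q = "chain_poly [:0, 1:] [:-2, 0, 1:]"
  \<comment> \<open>The path of \<open>Z_graph (n - 2)\<close>, prolonged at its end
    \<open>Inl 0\<close> by the leaf \<open>Inr 2\<close> as new vertex 0.\<close>
  define g :: "nat \<Rightarrow> (nat + nat) + nat" where "g i = (case i of 0 \<Rightarrow> Inr 2 | Suc j \<Rightarrow> Inl (Inl j))" for i
  let ?a = "Inl (Inr 0)" and ?b = "Inl (Inr 2)"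
  let ?u = "Inl (Inl 0)"
  let ?p = "map (\<lambda>i. Inl (Inl i)) [1..<n - 4] @ [?a, ?b]"
  have map_g: "map g [Suc i..<n - 3] = map (\<lambda>i. Inl (Inl i)) [i..<n - 4]" for i
  proof -
    have "map g [Suc i..<Suc (n - 4)] = map (g \<circ> Suc) [i..<n - 4]"
      by (simp add: map_Suc_upt[symmetric] del: upt_Suc)
    thus ?thesis
      using assms by (simp add: g_def comp_def Suc_diff_Suc eval_nat_numeral del: upt_Suc)
  qed
  have map_prod_Inl: "map_prod Inl Inl ` {(Inl i, Inl j) | i j. Q i j} =
      {(Inl (Inl i), Inl (Inl j)) | i j. Q i j}" for Q :: "nat \<Rightarrow> nat \<Rightarrow> bool"
    by (force simp: image_iff)
  have E: "parcs ?G =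
     {(Inl (Inl i), Inl (Inl j)) | i j. i < n - 4 \<and> j < n - 4 \<and> (j = Suc i \<or> i = Suc j)} \<union>
     {(Inl (Inl (n - 5)), ?a), (Inl (Inl (n - 5)), ?b), (?a, Inl (Inl (n - 5))), (?b, Inl (Inl (n - 5)))} \<union>
     {(?u, Inr 0), (?u, Inr 2), (Inr 0, ?u), (Inr 2, ?u)}"
    using assms by (simp add: parcs_W_graph parcs_Z_graph_eq image_Un map_prod_Inl)
  have "set (Inr 0 # ?u # Inr 2 # ?p) = pverts ?G"
    using assms by (auto simp: pverts_W_graph pverts_Z_graph image_iff)
  moreover have "distinct (Inr 0 # ?u # Inr 2 # ?p :: ((nat + nat) + nat) list)"
    by (auto simp: distinct_map inj_on_def)
  ultimately have "graph_char_poly ?G = list_char_poly ?G (Inr 0 # ?u # Inr 2 # ?p)"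
    by (intro graph_char_poly_eq)
  also have "\<dots> = ?X * list_char_poly ?G (?u # Inr 2 # ?p) - list_char_poly ?G (Inr 2 # ?p)"
    by (rule list_char_poly_pendant) (auto simp: E)
  also have "list_char_poly ?G (?u # Inr 2 # ?p) = list_char_poly ?G (Inr 2 # ?u # ?p)"
    by (rule list_char_poly_perm) (auto simp: distinct_map inj_on_def)
  also have "Inr 2 # ?u # ?p = map g [0..<n - 3] @ [?a, ?b]"
  proof -
    have "[0..<n - 3] = 0 # [1..<n - 3]" "[0..<n - 4] = 0 # [1..<n - 4]"
      using assms by (simp_all add: upt_conv_Cons)
    thus ?thesis
      using map_g[of 0] by (simp add: g_def del: upt_Suc)
  qed
  also have "list_char_poly ?G \<dots> = ?X * ?q (n - 3)"
  proof -
    have dist: "distinct (map g [0..<n - 3] @ [?a, ?b])"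
      by (auto simp: distinct_map inj_on_def g_def split: nat.splits)
    have "list_char_poly ?G (map g [(n - 3) - (n - 3)..<n - 3] @ [?a, ?b]) = ?X * ?q (n - 3)"
    proof (rule list_char_poly_fork[OF _ _ _ _ _ _ _ dist])
      fix i j assume "i < n - 3" "j < n - 3"
      thus "(g i, g j) \<in> parcs ?G \<longleftrightarrow> j = Suc i \<or> i = Suc j"
        using assms by (cases i; cases j) (auto simp: E g_def)
    next
      fix i and v :: "(nat + nat) + nat" assume "i < n - 3" "v \<in> {?a, ?b}"
      thus "((g i, v) \<in> parcs ?G \<longleftrightarrow> i = n - 3 - 1) \<and> ((v, g i) \<in> parcs ?G \<longleftrightarrow> i = n - 3 - 1)"
        using assms by (cases i) (auto simp: E g_def)
    qed (use assms in \<open>auto simp: E\<close>)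
    thus ?thesis by simp
  qed
  also have "list_char_poly ?G (Inr 2 # ?p) = ?X * list_char_poly ?G ?p"
    by (rule list_char_poly_isolated) (auto simp: E)
  also have "list_char_poly ?G ?p = ?X * ?q (n - 5)"
  proof -
    have dist: "distinct (map (\<lambda>i. Inl (Inl i)) [0..<n - 4] @ [?a, ?b :: (nat + nat) + nat])"
      by (auto simp: distinct_map inj_on_def)
    \<comment> \<open>Of the n - 4 path vertices the first one, \<open>?u\<close>, is
      dropped.\<close>
    have "list_char_poly ?G (map (\<lambda>i. Inl (Inl i)) [(n - 4) - (n - 5)..<n - 4] @ [?a, ?b]) = ?X * ?q (n - 5)"
      by (rule list_char_poly_fork[OF _ _ _ _ _ _ _ dist]) (use assms in \<open>auto simp: E\<close>)
    thus ?thesis using assms by simp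
  qed
  finally show ?thesis
    by (simp only: power2_eq_square algebra_simps)
qed

section \<open>The cycle, by discrete Fourier transform\<close>

text \<open>The adjacency matrix is circulant, so the characters of the cyclic group are
  eigenvectors with eigenvalues w^j + w^(-j). They are the columns of \<open>P\<close>, and
  \<open>Q\<close> is the conjugate of \<open>P\<close> divided by N, an inverse by orthogonality of
  characters.\<close>

lemma char_poly_cycle_complex:
  assumes "N \<ge> 3"
  shows "char_poly (map_mat complex_of_real (adjacency_mat (cycle_graph N) [0..<N])) =
    (\<Prod>j\<leftarrow>[0..<N]. [:- complex_of_real (2 * cos (2 * pi * j / N)), 1:])"
proof -
  define w where "w = cis (2 * pi / N)"
  define v where "v = cis (- (2 * pi / N))"
  define lam where "lam j = complex_of_real (2 * cos (2 * pi * real j / real N))" for j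
  define A where "A = map_mat complex_of_real (adjacency_mat (cycle_graph N) [0..<N])"
  define P where "P = mat N N (\<lambda>(i, j). w ^ (i * j))"
  define Q where "Q = mat N N (\<lambda>(i, j). v ^ (i * j) / of_nat N)"
  define D where "D = mat N N (\<lambda>(i, j). if i = j then lam j else 0)"
  have carrier: "A \<in> carrier_mat N N" "P \<in> carrier_mat N N" "Q \<in> carrier_mat N N" "D \<in> carrier_mat N N"
    by (simp_all add: A_def P_def Q_def D_def adjacency_mat_def)
  have wv: "w * v = 1"
    by (simp add: w_def v_def cis_mult)
  have wN: "w ^ N = 1"
    using assms by (simp add: w_def Complex.DeMoivre)
  have vN: "v ^ N = 1"
    using wv wN by (metis power_mult_distrib mult_1 power_one)
  \<comment> \<open>Distinct exponents below N give distinct powers of the primitive root, which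
    makes the off-diagonal geometric sums vanish.\<close>
  have inj: "inj_on (\<lambda>k. w ^ k) {..<N}"
    using bij_betw_imp_inj_on[OF Complex.bij_betw_roots_unity[of N]] assms
    by (simp add: w_def Complex.DeMoivre mult_ac)
  have w_mod: "w ^ (i mod N * j) = w ^ (i * j)" for i j
  proof -
    have "w ^ i = (w ^ N) ^ (i div N) * w ^ (i mod N)"
      by (simp flip: power_mult power_add)
    thus ?thesis
      by (simp add: wN power_mult)
  qed
  have "P * Q = 1\<^sub>m N"
  proof (rule eq_matI)
    fix i l assume "i < dim_row (1\<^sub>m N :: complex mat)" "l < dim_col (1\<^sub>m N :: complex mat)"
    hence il: "i < N" "l < N" by auto
    let ?z = "w ^ i * v ^ l"
    have "(P * Q) $$ (i, l) = (\<Sum>j = 0..<N. w ^ (i * j) * (v ^ (j * l) / of_nat N))"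
      using il by (simp add: P_def Q_def scalar_prod_def)
    also have "\<dots> = (\<Sum>j<N. ?z ^ j) / of_nat N"
      by (simp add: sum_divide_distrib atLeast0LessThan power_mult_distrib mult.commute flip: power_mult)
    also have "\<dots> = (if i = l then 1 else 0)"
    proof (cases "i = l")
      case True
      hence "?z = 1" by (simp add: wv flip: power_mult_distrib)
      thus ?thesis using True assms by simp
    next
      case False
      have "?z \<noteq> 1"
      proof
        assume "?z = 1"
        hence "w ^ i * (v ^ l * w ^ l) = w ^ l" by (simp flip: mult.assoc)
        hence "w ^ i = w ^ l" by (simp add: wv mult.commute[of v] flip: power_mult_distrib)
        thus False using inj_onD[OF inj] il False by auto
      qed
      moreover have "?z ^ N = (w ^ N) ^ i * (v ^ N) ^ l"
        by (simp add: power_mult_distrib mult.commute flip: power_mult)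
      ultimately show ?thesis
        using False by (simp add: sum_gp_strict wN vN)
    qed
    finally show "(P * Q) $$ (i, l) = 1\<^sub>m N $$ (i, l)"
      using il by simp
  qed (use carrier in auto)
  moreover from this have "Q * P = 1\<^sub>m N"
    using carrier mat_mult_left_right_inverse by blast
  moreover have "A * P = P * D"
  proof (rule eq_matI)
    fix i j assume "i < dim_row (P * D)" "j < dim_col (P * D)"
    hence ij: "i < N" "j < N" using carrier by auto
    \<comment> \<open>The predecessor of i modulo N; adding N - 1 avoids truncated subtraction at i
      = 0.\<close>
    let ?i' = "(i + (N - 1)) mod N"
    have nbr: "k = Suc i mod N \<or> i = Suc k mod N \<longleftrightarrow> k = Suc i mod N \<or> k = ?i'" if "k < N" for k
    proof -
      have "i = Suc k mod N \<longleftrightarrow> k = ?i'"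
      proof
        assume "i = Suc k mod N"
        hence "?i' = (Suc k + (N - 1)) mod N" by (simp add: mod_simps)
        thus "k = ?i'" using that by simp
      next
        assume "k = ?i'"
        hence "Suc k mod N = Suc (i + (N - 1)) mod N" by (simp add: mod_simps)
        thus "i = Suc k mod N" using ij by simp
      qed
      thus ?thesis by simp
    qed
    \<comment> \<open>For N = 2 successor and predecessor would coincide and the row sum would have
      a single term.\<close>
    have neq: "Suc i mod N \<noteq> ?i'"
    proof (cases i)
      case 0
      thus ?thesis using assms by simp
    next
      case (Suc i'')
      hence "?i' = i''" using ij by (simp add: mod_if)
      thus ?thesis using Suc ij assms by (auto simp: mod_if)
    qed
    have "(A * P) $$ (i, j) = (\<Sum>k<N. A $$ (i, k) * P $$ (k, j))"
      using ij carrier by (simp add: scalar_prod_def atLeast0LessThan)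
    also have "\<dots> = (\<Sum>k<N. if k \<in> {Suc i mod N, ?i'} then w ^ (k * j) else 0)"
      using ij nbr by (intro sum.cong) (auto simp: A_def P_def adjacency_mat_def cycle_graph_def)
    also have "\<dots> = (\<Sum>k\<in>{Suc i mod N, ?i'}. w ^ (k * j))"
    proof -
      have "{..<N} \<inter> {Suc i mod N, ?i'} = {Suc i mod N, ?i'}"
        using assms by auto
      thus ?thesis by (subst sum.inter_restrict[symmetric]) simp_all
    qed
    also have "\<dots> = w ^ (Suc i * j) + w ^ ((i + (N - 1)) * j)"
      using neq by (simp add: w_mod del: mult_Suc)
    also have "w ^ (N - 1) = v"
    proof -
      have "w ^ (N - 1) = w ^ (N - 1) * w * v" using wv by (simp add: mult.assoc)
      also have "w ^ (N - 1) * w = w ^ N" using assms power_Suc2[of w "N - 1"] by simp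
      finally show ?thesis by (simp add: wN)
    qed
    hence "w ^ ((i + (N - 1)) * j) = w ^ (i * j) * v ^ j"
      by (simp add: power_add power_mult power_mult_distrib)
    also have "w ^ (Suc i * j) + w ^ (i * j) * v ^ j = w ^ (i * j) * (w ^ j + v ^ j)"
      by (simp add: power_add algebra_simps)
    also have "w ^ j + v ^ j = lam j"
      by (rule complex_eqI) (simp_all add: w_def v_def lam_def Complex.DeMoivre mult_ac)
    also have "w ^ (i * j) * lam j = (P * D) $$ (i, j)"
      using ij carrier by (simp add: scalar_prod_def atLeast0LessThan P_def D_def
        if_distrib[of "\<lambda>x. _ * x"] sum.delta cong: if_cong)
    finally show "(A * P) $$ (i, j) = (P * D) $$ (i, j)" .
  qed (use carrier in auto)
  hence "A * (P * Q) = P * D * Q"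
    using carrier by (metis assoc_mult_mat)
  ultimately have "A = P * D * Q"
    using carrier by simp
  hence "similar_mat A D"
    by (intro similar_matI[of A D P Q N]) (use carrier \<open>P * Q = _\<close> \<open>Q * P = _\<close> in auto)
  hence "char_poly A = char_poly D"
    by (rule char_poly_similar)
  also have "\<dots> = (\<Prod>a\<leftarrow>diag_mat D. [:- a, 1:])"
    by (rule char_poly_upper_triangular[OF carrier(4)]) (auto simp: D_def)
  also have "diag_mat D = map lam [0..<N]"
    by (auto simp: diag_mat_def D_def intro!: map_cong)
  finally show ?thesis
    by (simp add: A_def lam_def comp_def)
qed

text \<open>The diagonalisation is complex while the claim is real; embedding real polynomials into
  complex ones is injective and commutes with \<open>char_poly\<close>.\<close>

lemma graph_char_poly_cycle:
  assumes "N \<ge> 3"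
  shows "graph_char_poly (cycle_graph N) = (\<Prod>j\<leftarrow>[0..<N]. [:- (2 * cos (2 * pi * real j / real N)), 1:])"
proof -
  let ?A = "adjacency_mat (cycle_graph N) [0..<N]"
  let ?q = "\<Prod>j\<leftarrow>[0..<N]. [:- (2 * cos (2 * pi * real j / real N)), 1:]"
  interpret poly_of_real: map_poly_inj_comm_ring_hom "of_real :: real \<Rightarrow> complex" ..
  have "map_poly complex_of_real (char_poly ?A) = char_poly (map_mat complex_of_real ?A)"
    by (rule of_real_hom.char_poly_hom[symmetric, of _ N]) (simp add: adjacency_mat_def)
  also have "\<dots> = map_poly complex_of_real ?q"
    unfolding char_poly_cycle_complex[OF assms] poly_of_real.hom_prod_list
    by (simp add: comp_def map_poly_pCons)
  finally have "char_poly ?A = ?q"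
    by (simp only: poly_of_real.eq_iff)
  moreover have "graph_char_poly (cycle_graph N) = char_poly ?A"
    by (rule graph_char_poly_eq) (auto simp: cycle_graph_def)
  ultimately show ?thesis by simp
qed

section \<open>Spectra\<close>

text \<open>Degree-many distinct roots leave no room for multiplicities or further roots: each
  counts at least once in \<open>proots p\<close>, whose size is at most the degree.\<close>

lemma proots_eq_mset_set:
  fixes p :: "'a :: idom poly"
  assumes "p \<noteq> 0" "finite S" "card S = degree p" "\<And>x. x \<in> S \<Longrightarrow> poly p x = 0"
  shows "proots p = mset_set S"
proof -
  have "mset_set S \<subseteq># proots p"
  proof (rule mset_subset_eqI)
    fix x
    show "count (mset_set S) x \<le> count (proots p) x"
      using assms order_root[of p x] by (cases "x \<in> S") (auto simp: count_mset_set)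
  qed
  moreover have "size (proots p) \<le> size (mset_set S)"
    using size_proots_le[of p] assms(3) by simp
  ultimately show ?thesis
    by (metis mset_subset_size subset_mset.less_le not_less)
qed

lemma proots_eq_image_mset:
  fixes p :: "'a :: idom poly"
  assumes "p \<noteq> 0" "degree p = n" "inj_on f {1..n}" "\<And>k. k \<in> {1..n} \<Longrightarrow> poly p (f k) = 0"
  shows "proots p = image_mset f (mset_set {1..n})"
proof -
  have "proots p = mset_set (f ` {1..n})"
    by (rule proots_eq_mset_set) (use assms card_image[of f "{1..n}"] in auto)
  thus ?thesis
    using assms(3) by (simp add: image_mset_mset_set)
qed

text \<open>A multiset symmetric about 0, stored through its upper half; for odd n the middle
  element is its own negative, hence 0.\<close>

definition half_spectrum :: "nat \<Rightarrow> (nat \<Rightarrow> real) \<Rightarrow> real multiset" where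
  "half_spectrum n f = image_mset f (mset_set {1..n div 2}) +
     image_mset (\<lambda>k. - f k) (mset_set {1..n div 2}) + replicate_mset (n mod 2) 0"

lemma half_spectrum_cong:
  assumes "\<And>k. k \<in> {1..n div 2} \<Longrightarrow> f k = g k"
  shows "half_spectrum n f = half_spectrum n g"
proof -
  have "image_mset f (mset_set {1..n div 2}) = image_mset g (mset_set {1..n div 2})"
    and "image_mset (\<lambda>k. - f k) (mset_set {1..n div 2}) = image_mset (\<lambda>k. - g k) (mset_set {1..n div 2})"
    using assms by (auto intro!: image_mset_cong)
  thus ?thesis
    by (simp add: half_spectrum_def)
qed

text \<open>The reflection of indices pairs the upper with the lower half; for odd n it fixes the
  middle index, where the hypothesis forces f to vanish.\<close>

lemma image_mset_eq_half_spectrum: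
  assumes "\<And>k. k \<in> {1..n} \<Longrightarrow> f (Suc n - k) = - f k"
  shows "image_mset f (mset_set {1..n}) = half_spectrum n f"
proof -
  let ?h = "n div 2"
  let ?M = "if odd n then {Suc ?h} else {}"
  have n: "n = 2 * ?h + n mod 2"
    by simp
  have "{1..n} = {1..?h} \<union> {Suc n - ?h..n} \<union> ?M"
    using n by (auto simp: odd_iff_mod_2_eq_one even_iff_mod_2_eq_zero)
  moreover have "{1..?h} \<inter> {Suc n - ?h..n} = {}"
    using n by auto
  moreover have "({1..?h} \<union> {Suc n - ?h..n}) \<inter> ?M = {}"
    by (auto simp: odd_iff_mod_2_eq_one; presburger)
  ultimately have split: "mset_set {1..n} = mset_set {1..?h} + mset_set {Suc n - ?h..n} + mset_set ?M"
    by (simp add: mset_set_Union)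
  have "{Suc n - ?h..n} = (\<lambda>k. Suc n - k) ` {1..?h}"
  proof (intro equalityI subsetI)
    fix x assume "x \<in> {Suc n - ?h..n}"
    thus "x \<in> (\<lambda>k. Suc n - k) ` {1..?h}"
      by (intro image_eqI[of _ _ "Suc n - x"]) auto
  qed auto
  moreover have "inj_on (\<lambda>k. Suc n - k) {1..?h}"
    by (rule inj_onI) auto
  ultimately have "mset_set {Suc n - ?h..n} = image_mset (\<lambda>k. Suc n - k) (mset_set {1..?h})"
    by (simp only: image_mset_mset_set)
  hence "image_mset f (mset_set {Suc n - ?h..n}) = image_mset (\<lambda>k. - f k) (mset_set {1..?h})"
    using assms by (auto simp: multiset.map_comp comp_def intro!: image_mset_cong)
  moreover have "image_mset f (mset_set ?M) = replicate_mset (n mod 2) 0"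
  proof (cases "odd n")
    case True
    hence "Suc n - Suc ?h = Suc ?h" "Suc ?h \<in> {1..n}"
      unfolding atLeastAtMost_iff by presburger+
    hence "f (Suc ?h) = 0"
      using assms[of "Suc ?h"] by simp
    thus ?thesis using True by (simp add: odd_iff_mod_2_eq_one)
  qed (simp add: even_iff_mod_2_eq_zero)
  ultimately show ?thesis
    by (simp only: half_spectrum_def split image_mset_union)
qed

text \<open>For even n the new zero becomes the middle element. For odd n it joins the zero already
  present, and together they form the pair at the new index n div 2 + 1.\<close>

lemma half_spectrum_add_zero:
  assumes "odd n \<Longrightarrow> f (Suc (n div 2)) = 0"
  shows "add_mset 0 (half_spectrum n f) = half_spectrum (Suc n) f"
proof (cases "odd n")
  case True
  hence "Suc n div 2 = Suc (n div 2)" "Suc n mod 2 = 0" "n mod 2 = 1"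
    by (auto simp: odd_iff_mod_2_eq_one)
  moreover have "{1..Suc (n div 2)} = insert (Suc (n div 2)) {1..n div 2}"
    by auto
  ultimately show ?thesis
    using assms True by (simp add: half_spectrum_def numeral_2_eq_2)
qed (auto simp: half_spectrum_def even_iff_mod_2_eq_zero)

lemma half_spectrum_add_two_zeros:
  assumes "f (Suc (n div 2)) = 0"
  shows "add_mset 0 (add_mset 0 (half_spectrum n f)) = half_spectrum (Suc (Suc n)) f"
proof -
  have "{1..Suc (n div 2)} = insert (Suc (n div 2)) {1..n div 2}"
    by auto
  thus ?thesis
    using assms by (simp add: half_spectrum_def)
qed

text \<open>The order and sign conditions make \<open>f\<close> enumerate the upper half in sorted
  order, so that positions in \<open>eigenvalue_list\<close> become explicit.\<close>

definition has_half_spectrum :: "'a pair_pre_digraph \<Rightarrow> nat \<Rightarrow> (nat \<Rightarrow> real) \<Rightarrow> bool" where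
  "has_half_spectrum G n f \<longleftrightarrow> card (pverts G) = n \<and>
     proots (graph_char_poly G) = half_spectrum n f \<and>
     antimono_on {1..n div 2} f \<and> (\<forall>k\<in>{1..n div 2}. f k \<ge> 0)"

lemma eigenvalue_list_half_spectrum:
  assumes "has_half_spectrum G n f"
  shows "eigenvalue_list G = map f [1..<Suc (n div 2)] @ replicate (n mod 2) 0 @
    map (\<lambda>k. - f k) (rev [1..<Suc (n div 2)])"
proof -
  let ?xs = "map f [1..<Suc (n div 2)] @ replicate (n mod 2) 0 @
    map (\<lambda>k. - f k) (rev [1..<Suc (n div 2)])"
  have "mset [1..<Suc (n div 2)] = mset_set {1..n div 2}"
    by (metis atLeastLessThanSuc_atLeastAtMost mset_upt)
  hence mset: "mset ?xs = proots (graph_char_poly G)"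
    using assms by (simp add: has_half_spectrum_def half_spectrum_def del: upt_Suc)
  have anti: "f j \<le> f i" if "i \<le> j" "i \<in> {1..n div 2}" "j \<in> {1..n div 2}" for i j
    using assms that by (auto simp: has_half_spectrum_def monotone_on_def)
  have nonneg: "f i \<ge> 0" if "i \<in> {1..n div 2}" for i
    using assms that by (auto simp: has_half_spectrum_def)
  have "sorted_wrt (\<ge>) ?xs"
    unfolding sorted_wrt_append sorted_wrt_map
  proof (intro conjI)
    have "sorted_wrt (<) [1..<Suc (n div 2)]" by (rule sorted_wrt_upt)
    thus "sorted_wrt (\<lambda>x y. f y \<le> f x) [1..<Suc (n div 2)]"
      by (rule sorted_wrt_mono_rel[rotated]) (use anti in auto)
    have "sorted_wrt (\<lambda>x y. y < x) (rev [1..<Suc (n div 2)])"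
      by (simp add: sorted_wrt_rev sorted_wrt_upt del: upt_Suc)
    thus "sorted_wrt (\<lambda>x y. - f y \<le> - f x) (rev [1..<Suc (n div 2)])"
      by (rule sorted_wrt_mono_rel[rotated]) (use anti in auto)
  next
    show "\<forall>x\<in>set (map f [1..<Suc (n div 2)]).
      \<forall>y\<in>set (replicate (n mod 2) 0 @ map (\<lambda>k. - f k) (rev [1..<Suc (n div 2)])). y \<le> x"
    proof (intro ballI)
      fix x y assume "x \<in> set (map f [1..<Suc (n div 2)])"
        and y: "y \<in> set (replicate (n mod 2) 0 @ map (\<lambda>k. - f k) (rev [1..<Suc (n div 2)]))"
      hence "x \<ge> 0" using nonneg by auto
      moreover have "y \<le> 0" using y nonneg by (auto split: if_splits)
      ultimately show "y \<le> x" by simp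
    qed
  qed (use nonneg in \<open>auto simp: sorted_wrt_iff_nth_less\<close>)
  hence "sorted (rev ?xs)"
    by (simp only: sorted_wrt_rev)
  hence "sorted_list_of_multiset (mset (rev ?xs)) = rev ?xs"
    by (simp only: sorted_list_of_multiset_mset sorted_sort_id)
  thus ?thesis
    using mset by (simp only: eigenvalue_list_def mset_rev rev_rev_ident)
qed

lemma graph_eigenvalue_half_spectrum:
  assumes "has_half_spectrum G n f"
  shows "k \<in> {1..n div 2} \<Longrightarrow> graph_eigenvalue G k = f k"
    and "k \<in> {1..n div 2} \<Longrightarrow> graph_eigenvalue G (Suc n - k) = - f k"
    and "odd n \<Longrightarrow> graph_eigenvalue G (Suc (n div 2)) = 0"
proof -
  let ?h = "n div 2"
  note eq = eigenvalue_list_half_spectrum[OF assms]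
  show "graph_eigenvalue G k = f k" if "k \<in> {1..n div 2}"
  proof -
    have "k - 1 < ?h" using that by auto
    thus ?thesis using that
      by (simp add: graph_eigenvalue_def eq nth_append del: upt_Suc)
  qed
  show "graph_eigenvalue G (Suc ?h) = 0" if "odd n"
    using that by (simp add: graph_eigenvalue_def eq nth_append odd_iff_mod_2_eq_one del: upt_Suc)
  show "graph_eigenvalue G (Suc n - k) = - f k" if "k \<in> {1..n div 2}"
  proof -
    \<comment> \<open>Lists are indexed from 0, the middle block has n mod 2 entries, and the
      negated half is listed backwards.\<close>
    have "Suc n - k - 1 = ?h + (n mod 2 + (?h - k))" and k: "?h - k < ?h" "1 \<le> k" "k \<le> ?h"
      using that by (simp_all, presburger)
    hence "graph_eigenvalue G (Suc n - k) = (map f [1..<Suc ?h] @ replicate (n mod 2) 0 @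
        map (\<lambda>k. - f k) (rev [1..<Suc ?h])) ! (?h + (n mod 2 + (?h - k)))"
      by (simp only: graph_eigenvalue_def eq)
    also have "\<dots> = map (\<lambda>k. - f k) (rev [1..<Suc ?h]) ! (?h - k)"
      using nth_append_length_plus[of "map f [1..<Suc ?h]" _ "n mod 2 + (?h - k)"]
        nth_append_length_plus[of "replicate (n mod 2) (0 :: real)" _ "?h - k"]
      by (simp del: upt_Suc)
    also have "\<dots> = - f k"
      using k by (simp add: rev_nth del: upt_Suc)
    finally show ?thesis .
  qed
qed

text \<open>Reflecting the index negates both eigenvalues and keeps their distance; the middle zeros
  for odd n contribute nothing.\<close>

lemma spectral_distance_half_spectrum:
  assumes G: "has_half_spectrum G n f" and H: "has_half_spectrum H n g"
  shows "spectral_distance G H = 2 * (\<Sum>k = 1..n div 2. \<bar>f k - g k\<bar>)"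
proof -
  let ?h = "n div 2"
  let ?d = "\<lambda>i. \<bar>graph_eigenvalue G i - graph_eigenvalue H i\<bar>"
  let ?M = "if odd n then {Suc ?h} else {}"
  have n: "n = 2 * ?h + n mod 2"
    by simp
  have split: "{1..n} = {1..?h} \<union> {Suc n - ?h..n} \<union> ?M"
    using n by (auto simp: odd_iff_mod_2_eq_one even_iff_mod_2_eq_zero)
  have disj: "{1..?h} \<inter> {Suc n - ?h..n} = {}"
    by auto
  have disj': "({1..?h} \<union> {Suc n - ?h..n}) \<inter> ?M = {}"
    by (auto simp: odd_iff_mod_2_eq_one; presburger)
  have "spectral_distance G H = (\<Sum>i\<in>{1..n}. ?d i)"
    using G by (simp add: spectral_distance_def has_half_spectrum_def)
  also have "\<dots> = (\<Sum>i=1..?h. ?d i) + (\<Sum>i\<in>{Suc n - ?h..n}. ?d i) + sum ?d ?M"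
    unfolding split using disj disj' by (subst sum.union_disjoint; (subst sum.union_disjoint)?) auto
  also have "sum ?d ?M = 0"
    using graph_eigenvalue_half_spectrum(3)[OF G] graph_eigenvalue_half_spectrum(3)[OF H] by simp
  also have "(\<Sum>i=1..?h. ?d i) = (\<Sum>k=1..?h. \<bar>f k - g k\<bar>)"
    using graph_eigenvalue_half_spectrum(1)[OF G] graph_eigenvalue_half_spectrum(1)[OF H]
    by (intro sum.cong) auto
  also have "(\<Sum>i\<in>{Suc n - ?h..n}. ?d i) = (\<Sum>k=1..?h. \<bar>f k - g k\<bar>)"
  proof (rule sum.reindex_bij_witness[of _ "\<lambda>k. Suc n - k" "\<lambda>k. Suc n - k"])
    fix i assume i: "i \<in> {Suc n - ?h..n}"
    hence "Suc n - i \<in> {1..?h}" by auto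
    from graph_eigenvalue_half_spectrum(2)[OF G this] graph_eigenvalue_half_spectrum(2)[OF H this]
    show "\<bar>f (Suc n - i) - g (Suc n - i)\<bar> = ?d i"
      using i by (simp add: abs_if)
  qed auto
  finally show ?thesis by simp
qed

section \<open>Cosine eigenvalues with shifted indices\<close>

definition shifted_cos :: "real \<Rightarrow> real \<Rightarrow> nat \<Rightarrow> nat \<Rightarrow> real" where
  "shifted_cos c d n k = 2 * cos (pi * ((real k + c) / (real n + d)))"

text \<open>The inequalities on c and m keep all angles within [0, pi], where cosine decreases
  strictly.\<close>

lemma shifted_cos_strict_antimono:
  assumes "real n + d > 0" "1 + c \<ge> 0" "real m + c \<le> real n + d" "1 \<le> k" "k < l" "l \<le> m"
  shows "shifted_cos c d n l < shifted_cos c d n k"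
proof -
  have "pi * ((real k + c) / (real n + d)) \<ge> 0"
    using assms by simp
  moreover have "pi * ((real k + c) / (real n + d)) < pi * ((real l + c) / (real n + d))"
    using assms by (simp add: divide_strict_right_mono)
  moreover have "(real l + c) / (real n + d) \<le> 1"
    using assms by simp
  hence "pi * ((real l + c) / (real n + d)) \<le> pi * 1"
    by (intro mult_left_mono) auto
  ultimately show ?thesis
    using cos_monotone_0_pi by (simp add: shifted_cos_def)
qed

lemma inj_on_shifted_cos:
  assumes "real n + d > 0" "1 + c \<ge> 0" "real m + c \<le> real n + d"
  shows "inj_on (shifted_cos c d n) {1..m}"
  using shifted_cos_strict_antimono[OF assms] by (intro linorder_inj_onI) (auto, fastforce)

lemma antimono_on_shifted_cos:
  assumes "real n + d > 0" "1 + c \<ge> 0" "real m + c \<le> real n + d"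
  shows "antimono_on {1..m} (shifted_cos c d n)"
  using shifted_cos_strict_antimono[OF assms] 
  by (intro monotone_onI) (metis atLeastAtMost_iff less_eq_real_def nat_less_le)

lemma shifted_cos_nonneg:
  assumes "real n + d > 0" "real k + c \<ge> 0" "2 * (real k + c) \<le> real n + d"
  shows "shifted_cos c d n k \<ge> 0"
proof -
  have "pi * ((real k + c) / (real n + d)) \<ge> 0"
    using assms by simp
  moreover have "(real k + c) / (real n + d) \<le> 1 / 2"
    using assms by (simp add: field_simps)
  hence "pi * ((real k + c) / (real n + d)) \<le> pi * (1 / 2)"
    by (intro mult_left_mono) auto
  ultimately show ?thesis
    using cos_ge_zero by (simp add: shifted_cos_def)
qed

text \<open>The hypothesis on m makes the angles at k and m + 1 - k add up to pi. In the
  applications m is the number of roots of the trigonometric factor: n, n - 1 and n - 2 for P, Z and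
  W.\<close>

lemma shifted_cos_reflect:
  assumes "real n + d > 0" "real m + 1 + 2 * c = real n + d" "k \<in> {1..m}"
  shows "shifted_cos c d n (Suc m - k) = - shifted_cos c d n k"
proof -
  have eq: "real (Suc m - k) + c = (real n + d) - (real k + c)"
    using assms by auto
  have "(real (Suc m - k) + c) / (real n + d) = 1 - (real k + c) / (real n + d)"
    unfolding eq using assms(1) by (simp only: diff_divide_distrib) simp
  hence "pi * ((real (Suc m - k) + c) / (real n + d)) = pi - pi * ((real k + c) / (real n + d))"
    by (simp only: right_diff_distrib mult_1_right)
  thus ?thesis
    by (simp add: shifted_cos_def)
qed

section \<open>Spectra of the four families\<close>

lemma has_half_spectrum_path:
  "has_half_spectrum (path_graph n) n (shifted_cos 0 1 n)"
proof -
  let ?f = "shifted_cos 0 1 n"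
  have deg: "degree (chain_poly 1 [:0, 1:] n) = n" "chain_poly 1 [:0, 1:] n \<noteq> 0"
    using degree_chain_poly[of 1 0 "[:0, 1:]" n] chain_poly_nonzero[of 1 0 "[:0, 1:]" n] by simp_all
  have "proots (graph_char_poly (path_graph n)) = image_mset ?f (mset_set {1..n})"
    unfolding graph_char_poly_path
  proof (rule proots_eq_image_mset)
    show "chain_poly 1 [:0, 1:] n \<noteq> 0" "degree (chain_poly 1 [:0, 1:] n) = n"
      using deg by auto
    show "inj_on ?f {1..n}"
      by (rule inj_on_shifted_cos) auto
    fix k assume k: "k \<in> {1..n}"
    let ?t = "pi * ((real k + 0) / (real n + 1))"
    have "sin ?t * poly (chain_poly 1 [:0, 1:] n) (2 * cos ?t) = sin (real k * pi)"
      unfolding poly_chain_poly_sin by (simp add: add.commute)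
    moreover have "(real k + 0) / (real n + 1) < 1"
      using k by simp
    hence "?t < pi * 1"
      by (rule mult_strict_left_mono) simp
    hence "sin ?t > 0"
      using k by (intro sin_gt_zero) auto
    ultimately show "poly (chain_poly 1 [:0, 1:] n) (?f k) = 0"
      by (simp add: shifted_cos_def)
  qed
  also have "\<dots> = half_spectrum n ?f"
    by (rule image_mset_eq_half_spectrum) (rule shifted_cos_reflect, auto)
  finally have "proots (graph_char_poly (path_graph n)) = half_spectrum n ?f" .
  moreover have "antimono_on {1..n div 2} ?f"
    by (rule antimono_on_shifted_cos) auto
  moreover have "?f k \<ge> 0" if "k \<in> {1..n div 2}" for k
    by (rule shifted_cos_nonneg) (use that in auto)
  ultimately show ?thesis
    by (simp add: has_half_spectrum_def card_pverts_graph)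
qed

lemma degree_chain_poly_cos:
  "degree (chain_poly [:0, 1:] [:-2, 0, 1:] n) = Suc n"
  "chain_poly [:0, 1:] [:-2, 0, 1:] n \<noteq> 0"
  using degree_chain_poly[of "[:0, 1:]" 1 "[:-2, 0, 1:]" n]
    chain_poly_nonzero[of "[:0, 1:]" 1 "[:-2, 0, 1:]" n] by auto

text \<open>The zeros of cos ((n - 1) t) are the half-odd multiples of pi / (n - 1), whence the
  shifts. The factor x adds an eigenvalue 0: the middle one for odd n, and for even n the partner of
  the zero that the formula itself gives at k = n div 2.\<close>

lemma has_half_spectrum_Z:
  assumes "n \<ge> 3"
  shows "has_half_spectrum (Z_graph n) n (shifted_cos (-1/2) (-1) n)"
proof -
  let ?f = "shifted_cos (-1/2) (-1) n" and ?q = "chain_poly [:0, 1:] [:-2, 0, 1:] (n - 2)"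
  have real_n: "real n \<ge> 3" "real (n - 1) = real n - 1" "real (n - 2 + 1) = real n - 1"
    using assms by auto
  have "?q \<noteq> 0"
    using degree_chain_poly_cos[of "n - 2"] by auto
  have "proots ?q = image_mset ?f (mset_set {1..n - 1})"
  proof (rule proots_eq_image_mset)
    show "?q \<noteq> 0" by fact
    show "degree ?q = n - 1"
      using degree_chain_poly_cos(1)[of "n - 2"] assms by simp
    show "inj_on ?f {1..n - 1}"
      by (rule inj_on_shifted_cos) (use real_n in auto)
    fix k assume k: "k \<in> {1..n - 1}"
    let ?t = "pi * ((real k + - 1 / 2) / (real n + - 1))"
    have "real (n - 2 + 1) * ?t = real k * pi - pi / 2"
      unfolding real_n using real_n(1) by (simp add: field_simps)
    hence "poly ?q (2 * cos ?t) = 0"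
      unfolding poly_chain_poly_cos by (simp add: cos_diff)
    thus "poly ?q (?f k) = 0"
      by (simp add: shifted_cos_def)
  qed
  also have "\<dots> = half_spectrum (n - 1) ?f"
    by (rule image_mset_eq_half_spectrum) (rule shifted_cos_reflect, use real_n in auto)
  finally have "proots (graph_char_poly (Z_graph n)) = add_mset 0 (half_spectrum (n - 1) ?f)"
    unfolding graph_char_poly_Z[OF assms] using \<open>?q \<noteq> 0\<close> by (subst proots_mult) auto
  also have "\<dots> = half_spectrum (Suc (n - 1)) ?f"
  proof (rule half_spectrum_add_zero)
    assume "odd (n - 1)"
    then obtain m where "n - 1 = 2 * m + 1" by (elim oddE)
    hence m: "n = 2 * m + 2" "(n - 1) div 2 = m" using assms by auto
    have half: "(real (Suc m) + - 1 / 2) / (real n + - 1) = 1 / 2"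
      unfolding m by (simp add: field_simps)
    show "?f (Suc ((n - 1) div 2)) = 0"
      unfolding m(2) shifted_cos_def half by simp
  qed
  finally have "proots (graph_char_poly (Z_graph n)) = half_spectrum n ?f"
    using assms by simp
  moreover have "antimono_on {1..n div 2} ?f"
    by (rule antimono_on_shifted_cos) (use real_n in auto)
  moreover have "?f k \<ge> 0" if "k \<in> {1..n div 2}" for k
    by (rule shifted_cos_nonneg) (use real_n that in auto)
  ultimately show ?thesis
    using assms by (simp add: has_half_spectrum_def Z_graph_simple)
qed

text \<open>The difference cos ((n - 2) t) - cos ((n - 4) t) equals -2 sin ((n - 3) t) sin t and
  vanishes at the multiples of pi / (n - 3). Index k belongs to the multiple k - 1, so the largest
  eigenvalue is 2, at t = 0. The factor x^2 supplies the innermost pair of zeros.\<close>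

lemma has_half_spectrum_W:
  assumes "n \<ge> 6"
  shows "has_half_spectrum (W_graph n) n ((shifted_cos (-1) (-3) n)(n div 2 := 0))"
proof -
  let ?f = "shifted_cos (-1) (-3) n" and ?q = "chain_poly [:0, 1:] [:-2, 0, 1:]"
  let ?g = "?f(n div 2 := 0)"
  let ?p = "?q (n - 3) - ?q (n - 5)"
  have real_n: "real n \<ge> 6" "real (n - 3 + 1) = real n - 2" "real (n - 5 + 1) = real n - 4"
      "real (n - 2) = real n - 2"
    using assms by auto
  have "degree (?q (n - 5)) < degree (?q (n - 3))"
    using assms by (simp add: degree_chain_poly_cos)
  hence deg: "degree ?p = degree (?q (n - 3))"
    using degree_add_eq_left[of "- ?q (n - 5)" "?q (n - 3)"] by simp
  hence deg': "degree ?p = n - 2"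
    using assms by (simp add: degree_chain_poly_cos)
  hence "?p \<noteq> 0"
    using assms by auto
  have "proots ?p = image_mset ?f (mset_set {1..n - 2})"
  proof (rule proots_eq_image_mset)
    show "?p \<noteq> 0" by fact
    show "degree ?p = n - 2" by fact
    show "inj_on ?f {1..n - 2}"
      by (rule inj_on_shifted_cos) (use real_n in auto)
    fix k assume k: "k \<in> {1..n - 2}"
    let ?t = "pi * ((real k + - 1) / (real n + - 3))" and ?s = "real (k - 1) * pi"
    have "(real n - 3) * ?t = ?s"
      using real_n(1) k by (simp add: field_simps)
    \<comment> \<open>Both frequencies are split as n - 3 plus or minus 1, because (n - 3) t is a
      multiple of pi.\<close>
    moreover have "(real n - 2) * x = (real n - 3) * x + x" "(real n - 4) * x = (real n - 3) * x - x" for x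
      by (simp_all add: algebra_simps)
    ultimately have "(real n - 2) * ?t = ?s + ?t" "(real n - 4) * ?t = ?s - ?t"
      by presburger+
    hence "poly ?p (2 * cos ?t) = 0"
      unfolding poly_diff poly_chain_poly_cos real_n by (simp only: cos_add cos_diff sin_npi) simp
    thus "poly ?p (?f k) = 0"
      by (simp add: shifted_cos_def)
  qed
  also have "\<dots> = half_spectrum (n - 2) ?f"
    by (rule image_mset_eq_half_spectrum) (rule shifted_cos_reflect, use real_n in auto)
  also have "\<dots> = half_spectrum (n - 2) ?g"
    by (rule half_spectrum_cong) (use assms in auto)
  finally have "proots (graph_char_poly (W_graph n)) = add_mset 0 (add_mset 0 (half_spectrum (n - 2) ?g))"
    unfolding graph_char_poly_W[OF assms] using \<open>?p \<noteq> 0\<close>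
    by (subst proots_mult) (simp_all add: proots_power numeral_2_eq_2 del: power_Suc)
  also have "\<dots> = half_spectrum (Suc (Suc (n - 2))) ?g"
    using assms by (intro half_spectrum_add_two_zeros) (simp add: div_if)
  finally have "proots (graph_char_poly (W_graph n)) = half_spectrum n ?g"
    using assms by (simp add: Suc_diff_Suc numeral_2_eq_2)
  \<comment> \<open>The index n div 2 is left out: for even n the angle there exceeds pi/2 and the
    cosine is negative.\<close>
  moreover have nonneg: "?f k \<ge> 0" if "k \<in> {1..n div 2 - 1}" for k
  proof (rule shifted_cos_nonneg)
    have "2 * k + 2 \<le> n" using that assms by auto
    hence "real (2 * k + 2) \<le> real n"
      by (rule of_nat_mono)
    thus "2 * (real k + - 1) \<le> real n + - 3"
      by simp
  qed (use real_n that in auto)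
  moreover have "antimono_on {1..n div 2} ?g"
  proof (rule monotone_onI)
    fix k l assume "k \<in> {1..n div 2}" "l \<in> {1..n div 2}" "k \<le> l"
    moreover have "antimono_on {1..n div 2} ?f"
      by (rule antimono_on_shifted_cos) (use real_n in auto)
    ultimately show "?g l \<le> ?g k"
      using nonneg[of k] by (auto simp: monotone_on_def)
  qed
  ultimately show ?thesis
    using assms by (auto simp: has_half_spectrum_def W_graph_simple)
qed

text \<open>Frequencies j and 2 m - j share an eigenvalue, so in decreasing order of eigenvalues the
  frequencies are 0, 1, 2 m - 1, 2, 2 m - 2, ..., m; hence the dependence on k div 2.\<close>

lemma has_half_spectrum_cycle:
  assumes "m \<ge> 2"
  shows "has_half_spectrum (cycle_graph (2 * m)) (2 * m) (\<lambda>k. shifted_cos 0 0 m (k div 2))"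
proof -
  let ?f = "\<lambda>k. shifted_cos 0 0 m (k div 2)"
  let ?c = "\<lambda>j. 2 * cos (2 * pi * real j / real (2 * m))"
  \<comment> \<open>From positions in the sorted spectrum to frequencies, with inverse
    \<open>\<tau>\<close>. Position 1 is separate because the odd case would give 2 m, which is out
    of range.\<close>
  define \<sigma> where "\<sigma> k = (if even k then k div 2 else if k = 1 then 0 else 2 * m - k div 2)" for k
  define \<tau> where "\<tau> j = (if j = 0 then 1 else if j \<le> m then 2 * j else 2 * (2 * m - j) + 1)" for j
  have "bij_betw \<sigma> {1..2 * m} {0..<2 * m}"
  proof (rule bij_betw_byWitness[of _ \<tau>])
    show "\<forall>k\<in>{1..2 * m}. \<tau> (\<sigma> k) = k"
      by (auto simp: \<sigma>_def \<tau>_def elim!: evenE oddE)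
    show "\<forall>j\<in>{0..<2 * m}. \<sigma> (\<tau> j) = j"
      by (auto simp: \<sigma>_def \<tau>_def)
    show "\<sigma> ` {1..2 * m} \<subseteq> {0..<2 * m}"
      using assms by (auto simp: \<sigma>_def elim!: evenE oddE)
    show "\<tau> ` {0..<2 * m} \<subseteq> {1..2 * m}"
      using assms by (auto simp: \<tau>_def)
  qed
  hence "mset_set {0..<2 * m} = image_mset \<sigma> (mset_set {1..2 * m})"
    by (simp only: image_mset_mset_set bij_betw_imp_inj_on bij_betw_imp_surj_on)
  moreover have "?c (\<sigma> k) = ?f k" if "k \<in> {1..2 * m}" for k
  proof (cases "even k \<or> k = 1")
    case False
    hence eq: "real (\<sigma> k) = 2 * real m - real (k div 2)"
      using that by (auto simp: \<sigma>_def)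
    have "2 * pi * real (\<sigma> k) / real (2 * m) = 2 * pi - pi * (real (k div 2) / real m)"
      unfolding eq using assms by (simp add: field_simps)
    thus ?thesis
      by (simp add: shifted_cos_def)
  qed (auto simp: \<sigma>_def shifted_cos_def)
  ultimately have "image_mset ?c (mset_set {0..<2 * m}) = image_mset ?f (mset_set {1..2 * m})"
    by (auto simp: multiset.map_comp comp_def intro!: image_mset_cong)
  also have "\<dots> = half_spectrum (2 * m) ?f"
  proof (rule image_mset_eq_half_spectrum)
    fix k assume "k \<in> {1..2 * m}"
    hence "(Suc (2 * m) - k) div 2 + k div 2 = m"
      unfolding atLeastAtMost_iff by presburger
    hence eq: "real ((Suc (2 * m) - k) div 2) = real m - real (k div 2)"
      by linarith
    have "pi * (real ((Suc (2 * m) - k) div 2) / real m) = pi - pi * (real (k div 2) / real m)"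
      unfolding eq using assms by (simp add: field_simps)
    thus "?f (Suc (2 * m) - k) = - ?f k"
      by (simp add: shifted_cos_def)
  qed
  also have "image_mset ?c (mset_set {0..<2 * m}) = proots (graph_char_poly (cycle_graph (2 * m)))"
  proof -
    have "proots (\<Prod>j\<leftarrow>xs. [:- ?c j, 1:]) = image_mset ?c (mset xs)" for xs
    proof (induction xs)
      case (Cons a xs)
      have "proots ([:- ?c a, 1:] * (\<Prod>j\<leftarrow>xs. [:- ?c j, 1:])) =
          proots [:- ?c a, 1:] + proots (\<Prod>j\<leftarrow>xs. [:- ?c j, 1:])"
        by (rule proots_mult) (auto simp: prod_list_zero_iff)
      thus ?case
        unfolding list.map prod_list.Cons Cons.IH by simp
    qed simp
    thus ?thesis
      using assms by (simp add: graph_char_poly_cycle)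
  qed
  finally have "proots (graph_char_poly (cycle_graph (2 * m))) = half_spectrum (2 * m) ?f" .
  moreover have "antimono_on {1..m} ?f"
  proof (rule monotone_onI)
    fix k l assume "k \<in> {1..m}" "l \<in> {1..m}" "k \<le> l"
    hence kl: "real (k div 2) \<le> real (l div 2)" "real (l div 2) \<le> real m"
      using div_le_mono[of k l 2] by auto
    have "pi * (real (k div 2) / real m) \<le> pi * (real (l div 2) / real m)"
      using kl by (intro mult_left_mono divide_right_mono) auto
    moreover have "pi * (real (l div 2) / real m) \<le> pi * 1"
      using kl assms by (intro mult_left_mono) auto
    ultimately show "?f l \<le> ?f k"
      by (simp add: shifted_cos_def cos_monotone_0_pi_le)
  qed
  moreover have "?f k \<ge> 0" if "k \<in> {1..m}" for k
    by (rule shifted_cos_nonneg) (use that assms in auto)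
  ultimately show ?thesis
    by (simp add: has_half_spectrum_def card_pverts_graph)
qed

section \<open>Asymptotics of the spectral distances\<close>

lemma abs_sin_diff_le: "\<bar>sin x - sin y\<bar> \<le> \<bar>x - y :: real\<bar>"
proof -
  have "\<bar>sin x - sin y\<bar> = 2 * \<bar>sin ((x - y) / 2)\<bar> * \<bar>cos ((x + y) / 2)\<bar>"
    by (simp add: sin_diff_sin abs_mult)
  also have "\<dots> \<le> 2 * \<bar>(x - y) / 2\<bar> * 1"
    by (intro mult_mono abs_sin_x_le_abs_x abs_cos_le_one) auto
  finally show ?thesis by simp
qed

text \<open>By the mean value theorem the increment is - h sin \<xi> with \<xi> within |h| of t, and
  sine is 1-Lipschitz.\<close>

lemma abs_cos_add_le: "\<bar>cos (t + h) - cos t + h * sin t\<bar> \<le> (h :: real)\<^sup>2"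
proof -
  have "\<exists>\<xi>. \<bar>\<xi> - t\<bar> \<le> \<bar>h\<bar> \<and> cos (t + h) - cos t = - h * sin \<xi>"
  proof (cases h "0 :: real" rule: linorder_cases)
    case less
    have "\<exists>\<xi>>t + h. \<xi> < t \<and> cos t - cos (t + h) = (t - (t + h)) * (- sin \<xi>)"
      by (rule MVT2) (use less in \<open>auto intro!: derivative_eq_intros\<close>)
    then obtain \<xi> where "t + h < \<xi>" "\<xi> < t" "cos t - cos (t + h) = (t - (t + h)) * (- sin \<xi>)"
      by blast
    thus ?thesis by (intro exI[of _ \<xi>]) auto
  next
    case greater
    have "\<exists>\<xi>>t. \<xi> < t + h \<and> cos (t + h) - cos t = (t + h - t) * (- sin \<xi>)"
      by (rule MVT2) (use greater in \<open>auto intro!: derivative_eq_intros\<close>)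
    then obtain \<xi> where "t < \<xi>" "\<xi> < t + h" "cos (t + h) - cos t = (t + h - t) * (- sin \<xi>)"
      by blast
    thus ?thesis by (intro exI[of _ \<xi>]) auto
  qed auto
  then obtain \<xi> where \<xi>: "\<bar>\<xi> - t\<bar> \<le> \<bar>h\<bar>" "cos (t + h) - cos t = - h * sin \<xi>"
    by blast
  have "\<bar>cos (t + h) - cos t + h * sin t\<bar> = \<bar>h\<bar> * \<bar>sin t - sin \<xi>\<bar>"
    unfolding \<xi>(2) by (simp add: abs_mult[symmetric] algebra_simps)
  also have "\<dots> \<le> \<bar>h\<bar> * \<bar>h\<bar>"
    using abs_sin_diff_le[of t \<xi>] \<xi>(1) by (intro mult_left_mono) auto
  finally show ?thesis
    by (simp add: power2_eq_square)
qed

text \<open>The perturbed fraction differs from x = k / n by exactly (c - d x) / (n + d), and n + d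
  is at least n / 2. With M = |c| + |d|, the part 8 pi^2 of the constant comes from the quadratic
  remainder at distance at most 2 M / n, the part 4 pi from replacing n + d by n in the linear
  term.\<close>

lemma shifted_cos_expansion:
  fixes n k :: nat
  assumes n: "real n \<ge> 1" "real n \<ge> 2 * \<bar>d\<bar>" and "k \<le> n"
  shows "\<bar>shifted_cos c d n k - (2 * cos (pi * (k / n)) - 2 * pi * sin (pi * (k / n)) * (c - d * (k / n)) / n)\<bar>
      \<le> (8 * pi\<^sup>2 + 4 * pi) * (\<bar>c\<bar> + \<bar>d\<bar>)\<^sup>2 / (real n)\<^sup>2"
proof -
  define x where "x = k / n"
  define u where "u = (k + c) / (n + d)"
  define M where "M = \<bar>c\<bar> + \<bar>d\<bar>"
  define r where "r = (u - x) - (c - d * x) / n"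
  have x: "0 \<le> x" "x \<le> 1"
    using \<open>k \<le> n\<close> n by (auto simp: x_def)
  have nd: "real n + d \<ge> real n / 2" "real n + d > 0"
    using n by (auto simp: abs_if split: if_splits)
  have "\<bar>c - d * x\<bar> \<le> \<bar>c\<bar> + \<bar>d\<bar> * \<bar>x\<bar>"
    by (metis abs_mult abs_triangle_ineq4)
  also have "\<bar>d\<bar> * \<bar>x\<bar> \<le> \<bar>d\<bar> * 1"
    using x by (intro mult_left_mono) auto
  finally have cdx: "\<bar>c - d * x\<bar> \<le> M"
    by (simp add: M_def)
  have ux: "u - x = (c - d * x) / (n + d)"
    using nd n by (simp add: u_def x_def field_simps)
  have "\<bar>u - x\<bar> = \<bar>c - d * x\<bar> / (n + d)"
    using nd by (simp add: ux)
  also have "\<dots> \<le> M / (n / 2)"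
    using nd n cdx by (intro frac_le) (auto simp: M_def)
  finally have ux_le: "\<bar>u - x\<bar> \<le> 2 * M / n"
    by (simp add: mult.commute)
  have "r = - d * (u - x) / n"
    using nd n unfolding r_def ux by (simp add: divide_simps) (simp add: algebra_simps)
  hence "\<bar>r\<bar> = \<bar>d\<bar> * \<bar>u - x\<bar> / n"
    by (simp add: abs_mult)
  also have "\<dots> \<le> M * (2 * M / n) / n"
    using ux_le by (intro divide_right_mono mult_mono) (auto simp: M_def)
  finally have r_le: "\<bar>r\<bar> \<le> 2 * M\<^sup>2 / (real n)\<^sup>2"
    by (simp add: power2_eq_square mult_ac)
  let ?h = "pi * (u - x)"
  have "shifted_cos c d n k - (2 * cos (pi * x) - 2 * pi * sin (pi * x) * (c - d * x) / n) =
     2 * (cos (pi * x + ?h) - cos (pi * x) + ?h * sin (pi * x)) - 2 * pi * sin (pi * x) * r"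
    by (simp add: shifted_cos_def r_def algebra_simps u_def)
  also have "\<bar>\<dots>\<bar> \<le> 2 * \<bar>cos (pi * x + ?h) - cos (pi * x) + ?h * sin (pi * x)\<bar> + 2 * pi * \<bar>sin (pi * x)\<bar> * \<bar>r\<bar>"
  proof -
    have "\<bar>2 * X - 2 * pi * S * r\<bar> \<le> 2 * \<bar>X\<bar> + 2 * pi * \<bar>S\<bar> * \<bar>r\<bar>" for X S
      using abs_triangle_ineq4[of "2 * X" "2 * pi * S * r"] by (simp add: abs_mult)
    thus ?thesis .
  qed
  also have "\<dots> \<le> 2 * ?h\<^sup>2 + 2 * pi * 1 * (2 * M\<^sup>2 / (real n)\<^sup>2)"
    using abs_cos_add_le[of "pi * x" ?h] r_le
    by (intro add_mono mult_mono mult_left_mono abs_sin_le_one) auto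
  also have "?h\<^sup>2 = pi\<^sup>2 * \<bar>u - x\<bar>\<^sup>2"
    by (simp add: power_mult_distrib)
  also have "2 * (pi\<^sup>2 * \<bar>u - x\<bar>\<^sup>2) \<le> 2 * (pi\<^sup>2 * (2 * M / n)\<^sup>2)"
    using ux_le by (intro mult_left_mono power_mono) auto
  also have "2 * (pi\<^sup>2 * (2 * M / n)\<^sup>2) + 2 * pi * 1 * (2 * M\<^sup>2 / (real n)\<^sup>2) =
      (8 * pi\<^sup>2 + 4 * pi) * M\<^sup>2 / (real n)\<^sup>2"
    by (simp add: power_mult_distrib power_divide add_divide_distrib distrib_right)
  finally show ?thesis
    unfolding x_def M_def by simp
qed

section \<open>Riemann sums with a moving upper limit\<close>

text \<open>On each cell the mean value theorem turns the increment of the primitive into a value of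
  f within 1 / n of the right endpoint, an error of at most L / n^2. At most n cells give L / n,
  uniformly in the upper limit, which then moves by continuity of the primitive.\<close>

lemma riemann_sum_tendsto:
  fixes f :: "real \<Rightarrow> real"
  assumes lip: "L-lipschitz_on {0..1} f"
    and K: "\<And>n. K n \<le> n" "(\<lambda>n. real (K n) / real n) \<longlonglongrightarrow> l"
  shows "(\<lambda>n. \<Sum>k = 1..K n. f (real k / n) / n) \<longlonglongrightarrow> integral {0..l} f"
proof -
  define F where "F x = integral {0..x} f" for x
  have cont: "continuous_on {0..1} f"
    using lip by (rule lipschitz_on_continuous_on)
  have F: "(F has_real_derivative f x) (at x within {0..1})" if "x \<in> {0..1}" for x
    unfolding F_def by (rule integral_has_real_derivative[OF cont that])
  \<comment> \<open>True at n = 0 as well, where division by zero gives 0.\<close>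
  have K01: "real (K n) / real n \<in> {0..1}" for n
    using K(1)[of n] by (auto simp: divide_le_eq_1)
  have l: "l \<in> {0..1}"
    using closed_sequentially[OF closed_atLeastAtMost _ K(2)] K01 by blast
  have "continuous_on {0..1} F"
    using F by (intro DERIV_continuous_on) 
  hence lim_F: "(\<lambda>n. F (real (K n) / real n)) \<longlonglongrightarrow> F l"
    by (rule continuous_on_tendsto_compose[OF _ K(2) l]) (use K01 in auto)
  have step: "\<bar>f (Suc k / n) / n - (F (Suc k / n) - F (k / n))\<bar> \<le> L / (real n)\<^sup>2"
    if "k < n" for k n :: nat
  proof -
    let ?a = "real k / n" and ?b = "real (Suc k) / n"
    have ab: "?a < ?b" "{?a..?b} \<subseteq> {0..1}" "?b - ?a = 1 / n"
      using that by (auto simp: field_simps)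
    have "\<exists>\<xi>\<in>{?a<..<?b}. F ?b - F ?a = (\<lambda>h. f \<xi> * h) (?b - ?a)"
    proof (rule mvt_simple)
      fix x assume x: "?a \<le> x" "x \<le> ?b"
      have "0 \<le> ?a"
        by simp
      hence "0 \<le> x"
        using x(1) by (rule order_trans)
      hence "x \<in> {0..1}"
        using x ab(1,2) by auto
      hence "(F has_real_derivative f x) (at x within {?a..?b})"
        using F ab(2) by (blast intro: DERIV_subset)
      thus "(F has_derivative (\<lambda>h. f x * h)) (at x within {?a..?b})"
        by (simp add: has_field_derivative_def)
    qed (use ab in auto)
    then obtain \<xi> where \<xi>: "\<xi> \<in> {?a<..<?b}" "F ?b - F ?a = f \<xi> * (1 / n)"
      unfolding ab(3) by blast
    have "\<bar>f ?b - f \<xi>\<bar> \<le> L * \<bar>?b - \<xi>\<bar>"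
      using lipschitz_onD[OF lip, of ?b \<xi>] \<xi>(1) ab by (auto simp: dist_real_def subset_iff)
    also have "\<dots> \<le> L * (1 / n)"
      using \<xi>(1) ab lipschitz_on_nonneg[OF lip] by (intro mult_left_mono) auto
    finally have "\<bar>f ?b - f \<xi>\<bar> / n \<le> L * (1 / n) / n"
      by (rule divide_right_mono) simp
    thus ?thesis
      unfolding \<xi>(2) by (simp add: power2_eq_square flip: diff_divide_distrib)
  qed
  have bound: "\<bar>(\<Sum>k = 1..K n. f (real k / n) / n) - F (real (K n) / real n)\<bar> \<le> L / n" for n
  proof -
    have "F 0 = 0" by (simp add: F_def)
    hence "F (real (K n) / real n) = (\<Sum>k<K n. F (Suc k / n) - F (k / n))"
      using sum_lessThan_telescope[of "\<lambda>k. F (k / n)" "K n"] by simp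
    moreover have "(\<Sum>k = 1..K n. f (real k / n) / n) = (\<Sum>k<K n. f (Suc k / n) / n)"
      unfolding One_nat_def by (rule sum.atLeast1_atMost_eq)
    ultimately have "\<bar>(\<Sum>k = 1..K n. f (real k / n) / n) - F (real (K n) / real n)\<bar> =
        \<bar>\<Sum>k<K n. f (Suc k / n) / n - (F (Suc k / n) - F (k / n))\<bar>"
      by (simp add: sum_subtractf)
    also have "\<dots> \<le> (\<Sum>k<K n. L / (real n)\<^sup>2)"
      using K(1)[of n] by (intro order_trans[OF sum_abs] sum_mono step) auto
    also have "\<dots> = real (K n) * (L / (real n)\<^sup>2)"
      by simp
    also have "\<dots> \<le> real n * (L / (real n)\<^sup>2)"
      using K(1)[of n] lipschitz_on_nonneg[OF lip] by (intro mult_right_mono) auto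
    also have "\<dots> = L / n"
      by (simp add: power2_eq_square)
    finally show ?thesis .
  qed
  have "(\<lambda>n. (\<Sum>k = 1..K n. f (real k / n) / n) - F (real (K n) / real n)) \<longlonglongrightarrow> 0"
  proof (rule Lim_null_comparison)
    show "\<forall>\<^sub>F n in sequentially. norm ((\<Sum>k = 1..K n. f (real k / n) / n) - F (real (K n) / real n)) \<le> L / n"
      using bound by simp
    show "(\<lambda>n. L / real n) \<longlonglongrightarrow> 0"
      by (rule lim_const_over_n)
  qed
  from tendsto_add[OF this lim_F] show ?thesis
    by (simp add: F_def)
qed

text \<open>Product rule for Lipschitz constants: sin (pi x) has bound 1 and constant pi, and |a - b
  x| has bound |a| + |b| and constant |b| on the unit interval.\<close>

lemma lipschitz_on_sin_abs:
  "(2 * pi * (pi * (\<bar>a\<bar> + \<bar>b\<bar>) + \<bar>b\<bar>))-lipschitz_on {0..1} (\<lambda>x. 2 * pi * (sin (pi * x) * \<bar>a - b * x\<bar>))"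
proof (rule lipschitz_onI)
  fix x y :: real assume xy: "x \<in> {0..1}" "y \<in> {0..1}"
  have "sin (pi * x) * \<bar>a - b * x\<bar> - sin (pi * y) * \<bar>a - b * y\<bar> =
      (sin (pi * x) - sin (pi * y)) * \<bar>a - b * x\<bar> + sin (pi * y) * (\<bar>a - b * x\<bar> - \<bar>a - b * y\<bar>)"
    by (simp add: algebra_simps)
  also have "\<bar>\<dots>\<bar> \<le> \<bar>sin (pi * x) - sin (pi * y)\<bar> * \<bar>a - b * x\<bar> + \<bar>sin (pi * y)\<bar> * \<bar>\<bar>a - b * x\<bar> - \<bar>a - b * y\<bar>\<bar>"
    by (rule order_trans[OF abs_triangle_ineq]) (simp add: abs_mult)
  also have "\<dots> \<le> (pi * \<bar>x - y\<bar>) * (\<bar>a\<bar> + \<bar>b\<bar>) + 1 * (\<bar>b\<bar> * \<bar>x - y\<bar>)"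
  proof (intro add_mono mult_mono abs_sin_le_one)
    show "\<bar>sin (pi * x) - sin (pi * y)\<bar> \<le> pi * \<bar>x - y\<bar>"
      using abs_sin_diff_le[of "pi * x" "pi * y"] by (simp add: abs_mult flip: right_diff_distrib)
    have "\<bar>b * x\<bar> \<le> \<bar>b\<bar> * 1"
      unfolding abs_mult using xy by (intro mult_left_mono) auto
    thus "\<bar>a - b * x\<bar> \<le> \<bar>a\<bar> + \<bar>b\<bar>"
      by linarith
    have "\<bar>\<bar>a - b * x\<bar> - \<bar>a - b * y\<bar>\<bar> \<le> \<bar>b * x - b * y\<bar>"
      by linarith
    thus "\<bar>\<bar>a - b * x\<bar> - \<bar>a - b * y\<bar>\<bar> \<le> \<bar>b\<bar> * \<bar>x - y\<bar>"
      by (simp add: abs_mult flip: right_diff_distrib)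
  qed auto
  finally have "2 * pi * \<bar>sin (pi * x) * \<bar>a - b * x\<bar> - sin (pi * y) * \<bar>a - b * y\<bar>\<bar> \<le>
      2 * pi * ((pi * \<bar>x - y\<bar>) * (\<bar>a\<bar> + \<bar>b\<bar>) + 1 * (\<bar>b\<bar> * \<bar>x - y\<bar>))"
    by (intro mult_left_mono) auto
  moreover have "dist (2 * pi * X) (2 * pi * Y) = 2 * pi * \<bar>X - Y\<bar>" for X Y
    by (simp add: dist_real_def abs_mult flip: right_diff_distrib)
  moreover have "2 * pi * ((pi * \<bar>x - y\<bar>) * (\<bar>a\<bar> + \<bar>b\<bar>) + 1 * (\<bar>b\<bar> * \<bar>x - y\<bar>)) =
      2 * pi * (pi * (\<bar>a\<bar> + \<bar>b\<bar>) + \<bar>b\<bar>) * dist x y"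
    by (simp add: dist_real_def algebra_simps)
  ultimately show "dist (2 * pi * (sin (pi * x) * \<bar>a - b * x\<bar>)) (2 * pi * (sin (pi * y) * \<bar>a - b * y\<bar>)) \<le>
      2 * pi * (pi * (\<bar>a\<bar> + \<bar>b\<bar>) + \<bar>b\<bar>) * dist x y"
    by simp
qed auto

text \<open>The leading cosines of the two expansions cancel. What remains is the density at k / n
  divided by n, up to B / n^2 per term and hence B / n in total.\<close>

lemma sum_shifted_cos_tendsto:
  assumes K: "\<And>n. K n \<le> n" "(\<lambda>n. real (K n) / real n) \<longlonglongrightarrow> l"
  shows "(\<lambda>n. \<Sum>k = 1..K n. \<bar>shifted_cos c d n k - shifted_cos c' d' n k\<bar>) \<longlonglongrightarrow>
    integral {0..l} (\<lambda>x. 2 * pi * (sin (pi * x) * \<bar>(c - c') - (d - d') * x\<bar>))"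
proof -
  let ?g = "\<lambda>x. 2 * pi * (sin (pi * x) * \<bar>(c - c') - (d - d') * x\<bar>)"
  let ?D = "\<lambda>n k. shifted_cos c d n k - shifted_cos c' d' n k"
  let ?C = "(8 * pi\<^sup>2 + 4 * pi) * (\<bar>c\<bar> + \<bar>d\<bar>)\<^sup>2" and ?C' = "(8 * pi\<^sup>2 + 4 * pi) * (\<bar>c'\<bar> + \<bar>d'\<bar>)\<^sup>2"
  define B where "B = ?C + ?C'"
  have "B \<ge> 0" by (simp add: B_def)
  have close: "\<bar>\<bar>?D n k\<bar> - ?g (real k / n) / n\<bar> \<le> B / (real n)\<^sup>2"
    if n: "real n \<ge> 1" "real n \<ge> 2 * \<bar>d\<bar>" "real n \<ge> 2 * \<bar>d'\<bar>" and "k \<le> n" for n k :: nat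
  proof -
    let ?x = "real k / n"
    \<comment> \<open>A nonnegative sine lets the absolute value rest on the linear factor
      alone.\<close>
    have "sin (pi * ?x) \<ge> 0"
      using \<open>k \<le> n\<close> n by (intro sin_ge_zero) (auto simp: divide_simps)
    hence g: "?g ?x / n = \<bar>2 * pi * sin (pi * ?x) * ((c - c') - (d - d') * ?x) / n\<bar>"
      by (simp add: abs_mult)
    \<comment> \<open>A sum on the right, because the linear term of the expansion carries a minus
      sign.\<close>
    have "\<bar>\<bar>X\<bar> - \<bar>Y\<bar>\<bar> \<le> \<bar>X + Y\<bar>" for X Y :: real
      by linarith
    hence "\<bar>\<bar>?D n k\<bar> - ?g ?x / n\<bar> \<le> \<bar>?D n k + 2 * pi * sin (pi * ?x) * ((c - c') - (d - d') * ?x) / n\<bar>"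
      unfolding g .
    also have "2 * pi * sin (pi * ?x) * ((c - c') - (d - d') * ?x) / n =
        2 * pi * sin (pi * ?x) * (c - d * ?x) / n - 2 * pi * sin (pi * ?x) * (c' - d' * ?x) / n"
      by (simp add: algebra_simps add_divide_distrib diff_divide_distrib)
    also have "\<bar>?D n k + \<dots>\<bar> \<le> ?C / (real n)\<^sup>2 + ?C' / (real n)\<^sup>2"
      using shifted_cos_expansion[OF n(1,2) \<open>k \<le> n\<close>, of c]
        shifted_cos_expansion[OF n(1,3) \<open>k \<le> n\<close>, of c'] by linarith
    finally show ?thesis by (simp add: B_def add_divide_distrib)
  qed
  have "(\<lambda>n. (\<Sum>k = 1..K n. \<bar>?D n k\<bar>) - (\<Sum>k = 1..K n. ?g (real k / n) / n)) \<longlonglongrightarrow> 0"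
  proof (rule Lim_null_comparison)
    have "\<forall>\<^sub>F n in sequentially. real n \<ge> max 1 (max (2 * \<bar>d\<bar>) (2 * \<bar>d'\<bar>))"
      using filterlim_real_sequentially unfolding filterlim_at_top by blast
    thus "\<forall>\<^sub>F n in sequentially. norm ((\<Sum>k = 1..K n. \<bar>?D n k\<bar>) - (\<Sum>k = 1..K n. ?g (real k / n) / n)) \<le> B / n"
    proof eventually_elim
      case (elim n)
      have "\<bar>(\<Sum>k = 1..K n. \<bar>?D n k\<bar>) - (\<Sum>k = 1..K n. ?g (real k / n) / n)\<bar> =
          \<bar>\<Sum>k = 1..K n. \<bar>?D n k\<bar> - ?g (real k / n) / n\<bar>"
        by (simp add: sum_subtractf)
      also have "\<dots> \<le> (\<Sum>k = 1..K n. B / (real n)\<^sup>2)"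
      proof (intro order_trans[OF sum_abs] sum_mono)
        fix k assume "k \<in> {1..K n}"
        hence "\<bar>\<bar>?D n k\<bar> - ?g (real k / n) / n\<bar> \<le> B / (real n)\<^sup>2"
          using K(1)[of n] elim by (intro close) auto
        thus "\<bar>\<bar>?D n k\<bar> - ?g (real k / n) / n\<bar> \<le> B / (real n)\<^sup>2" .
      qed
      also have "\<dots> = real (K n) * (B / (real n)\<^sup>2)"
        by simp
      also have "\<dots> \<le> real n * (B / (real n)\<^sup>2)"
        using K(1)[of n] \<open>B \<ge> 0\<close> by (intro mult_right_mono) auto
      also have "\<dots> = B / n"
        by (simp add: power2_eq_square)
      finally show ?case by simp
    qed
    show "(\<lambda>n. B / real n) \<longlonglongrightarrow> 0"
      by (rule lim_const_over_n)
  qed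
  moreover have "(\<lambda>n. \<Sum>k = 1..K n. ?g (real k / n) / n) \<longlonglongrightarrow> integral {0..l} ?g"
    using riemann_sum_tendsto[OF lipschitz_on_sin_abs[of "c - c'" "d - d'"] K] by simp
  ultimately have "(\<lambda>n. ((\<Sum>k = 1..K n. \<bar>?D n k\<bar>) - (\<Sum>k = 1..K n. ?g (real k / n) / n)) +
      (\<Sum>k = 1..K n. ?g (real k / n) / n)) \<longlonglongrightarrow> 0 + integral {0..l} ?g"
    by (rule tendsto_add)
  thus ?thesis
    by (simp only: diff_add_cancel add_0)
qed

section \<open>Evaluation of the limit integrals\<close>

lemma integral_sin_linear:
  fixes a b l r :: real
  assumes "l \<le> r"
  shows "((\<lambda>x. 2 * pi * (sin (pi * x) * (a - b * x))) has_integral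
    (2 * (cos (pi * l) * (a - b * l) - cos (pi * r) * (a - b * r)) +
     2 * b / pi * (sin (pi * l) - sin (pi * r)))) {l..r}"
proof -
  \<comment> \<open>Integration by parts, differentiating a - b x.\<close>
  let ?G = "\<lambda>x. - 2 * (cos (pi * x) * (a - b * x)) - 2 * b / pi * sin (pi * x)"
  have "((\<lambda>x. 2 * pi * (sin (pi * x) * (a - b * x))) has_integral (?G r - ?G l)) {l..r}"
  proof (rule fundamental_theorem_of_calculus[OF assms])
    fix x assume "x \<in> {l..r}"
    have "(?G has_real_derivative 2 * pi * (sin (pi * x) * (a - b * x))) (at x within {l..r})"
      by (auto intro!: derivative_eq_intros simp: algebra_simps)
    thus "(?G has_vector_derivative 2 * pi * (sin (pi * x) * (a - b * x))) (at x within {l..r})"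
      by (simp add: has_real_derivative_iff_has_vector_derivative)
  qed
  thus ?thesis
    by (simp add: algebra_simps)
qed

text \<open>The linear factor vanishes at 1/4, so the interval is cut there and a, b change sign on
  the second piece.\<close>

lemma integral_sin_abs_quarter:
  "integral {0..1/2} (\<lambda>x. 2 * pi * (sin (pi * x) * \<bar>1/2 - 2 * x\<bar>)) = (4 - 4 * sqrt 2 + pi) / pi"
proof -
  let ?g = "\<lambda>x. 2 * pi * (sin (pi * x) * \<bar>1/2 - 2 * x\<bar>)"
  have s: "sin (pi * (1/4)) = sqrt 2 / 2" "sin (pi * (1/2)) = 1"
    using sin_45 by simp_all
  have "((\<lambda>x. 2 * pi * (sin (pi * x) * (1/2 - 2 * x))) has_integral (1 - 2 * sqrt 2 / pi)) {0..1/4}"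
    using integral_sin_linear[of 0 "1/4" "1/2" 2] unfolding s by simp
  hence left: "(?g has_integral (1 - 2 * sqrt 2 / pi)) {0..1/4}"
    by (rule has_integral_eq[rotated]) simp
  have "((\<lambda>x. 2 * pi * (sin (pi * x) * (- (1/2) - (- 2) * x))) has_integral (- 2 * sqrt 2 / pi + 4 / pi)) {1/4..1/2}"
    using integral_sin_linear[of "1/4" "1/2" "- (1/2)" "- 2"] unfolding s
    by (simp add: diff_divide_distrib right_diff_distrib)
  hence right: "(?g has_integral (- 2 * sqrt 2 / pi + 4 / pi)) {1/4..1/2}"
    by (rule has_integral_eq[rotated]) simp
  have "(?g has_integral (1 - 2 * sqrt 2 / pi + (- 2 * sqrt 2 / pi + 4 / pi))) {0..1/2}"
    by (rule has_integral_combine[OF _ _ left right]) auto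
  hence "integral {0..1/2} ?g = 1 - 2 * sqrt 2 / pi + (- 2 * sqrt 2 / pi + 4 / pi)"
    by (rule integral_unique)
  also have "\<dots> = (4 - 4 * sqrt 2 + pi) / pi"
    by (simp add: field_simps)
  finally show ?thesis .
qed

text \<open>Neither linear factor changes sign on the interval; the two integrals are 1/2 - 1/pi and
  1/2 + 1/pi.\<close>

lemma integral_sin_abs_even_odd:
  "integral {0..1/2} (\<lambda>x. 2 * pi * (sin (pi * x) * \<bar>1/4 - 1/2 * x\<bar>)) +
   integral {0..1/2} (\<lambda>x. 2 * pi * (sin (pi * x) * \<bar>- 1/4 - 1/2 * x\<bar>)) = 1"
proof -
  have "((\<lambda>x. 2 * pi * (sin (pi * x) * (1/4 - 1/2 * x))) has_integral (1/2 - 1 / pi)) {0..1/2}"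
    using integral_sin_linear[of 0 "1/2" "1/4" "1/2"] by simp
  hence even: "((\<lambda>x. 2 * pi * (sin (pi * x) * \<bar>1/4 - 1/2 * x\<bar>)) has_integral (1/2 - 1 / pi)) {0..1/2}"
    by (rule has_integral_eq[rotated]) simp
  have "((\<lambda>x. 2 * pi * (sin (pi * x) * (1/4 - (-1/2) * x))) has_integral (1/2 + 1 / pi)) {0..1/2}"
    using integral_sin_linear[of 0 "1/2" "1/4" "-1/2"] by simp
  hence odd: "((\<lambda>x. 2 * pi * (sin (pi * x) * \<bar>- 1/4 - 1/2 * x\<bar>)) has_integral (1/2 + 1 / pi)) {0..1/2}"
    by (rule has_integral_eq[rotated]) simp
  show ?thesis
    unfolding integral_unique[OF even] integral_unique[OF odd] by simp
qed

lemma limit_value_approx: "\<bar>(8 - 8 * sqrt 2 + 2 * pi) / pi - 0.945\<bar> < 0.0005"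
proof -
  have "sqrt 2 > 1.4142"
    by (rule real_less_rsqrt) (simp add: power2_eq_square)
  moreover have "sqrt 2 < 1.4143"
    by (rule real_less_lsqrt) (simp_all add: power2_eq_square)
  \<comment> \<open>The claim multiplied by pi, with 1.055 = 2 - 0.945.\<close>
  ultimately have "\<bar>8 - 8 * sqrt 2 + 1.055 * pi\<bar> < 0.0005 * pi"
    using pi_approx by (simp add: abs_if)
  hence "\<bar>8 - 8 * sqrt 2 + 1.055 * pi\<bar> / pi < 0.0005"
    by (simp add: divide_less_eq)
  moreover have "(8 - 8 * sqrt 2 + 2 * pi) / pi - 0.945 = (8 - 8 * sqrt 2 + 1.055 * pi) / pi"
    by (simp add: field_simps)
  ultimately show ?thesis
    by (simp only: abs_divide) simp
qed

section \<open>Truncation points and boundary terms\<close>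

text \<open>The slack 2 covers both truncation points that occur, n div 2 and (n - 1) div 2.\<close>

lemma ratio_tendsto_half:
  assumes "\<And>n. \<bar>2 * real (K n) - real n\<bar> \<le> 2"
  shows "(\<lambda>n. real (K n) / real n) \<longlonglongrightarrow> 1 / 2"
proof -
  have "(\<lambda>n. real (K n) / real n - 1 / 2) \<longlonglongrightarrow> 0"
  proof (rule Lim_null_comparison)
    have "norm (real (K n) / real n - 1 / 2) \<le> 1 / real n" if "n > 0" for n
    proof -
      have "real (K n) / real n - 1 / 2 = (2 * real (K n) - real n) / (2 * real n)"
        using that by (simp add: field_simps)
      also have "norm \<dots> \<le> 2 / (2 * real n)"
        unfolding real_norm_def abs_divide using assms[of n] that by (intro frac_le) auto
      finally show ?thesis by simp
    qed
    thus "\<forall>\<^sub>F n in sequentially. norm (real (K n) / real n - 1 / 2) \<le> 1 / real n"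
      using eventually_gt_at_top[of 0] by (rule eventually_mono[rotated])
  qed (rule lim_const_over_n)
  thus ?thesis
    by (simp add: LIM_zero_iff)
qed

lemma shifted_ratio_tendsto:
  assumes "(\<lambda>n. real (K n) / real n) \<longlonglongrightarrow> l"
  shows "(\<lambda>n. (real (K n) + c) / (real n + d)) \<longlonglongrightarrow> l"
proof -
  have "(\<lambda>n. (real (K n) / real n + c / real n) / (1 + d / real n)) \<longlonglongrightarrow> (l + 0) / (1 + 0)"
    using assms by (intro tendsto_divide tendsto_add tendsto_const lim_const_over_n) auto
  moreover have "\<forall>\<^sub>F n in sequentially. (real (K n) / real n + c / real n) / (1 + d / real n) =
      (real (K n) + c) / (real n + d)"
    using eventually_gt_at_top[of 0]
  proof eventually_elim
    case (elim n)
    have "(real (K n) + c) / (real n + d) = ((real (K n) + c) / real n) / ((real n + d) / real n)"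
      using elim by simp
    thus ?case
      using elim by (simp add: add_divide_distrib)
  qed
  ultimately show ?thesis
    by (simp add: tendsto_cong)
qed

lemma shifted_cos_tendsto:
  assumes "(\<lambda>n. real (K n) / real n) \<longlonglongrightarrow> l"
  shows "(\<lambda>n. shifted_cos c d n (K n)) \<longlonglongrightarrow> 2 * cos (pi * l)"
  unfolding shifted_cos_def by (intro tendsto_intros shifted_ratio_tendsto assms)

lemma half_ratio_tendsto: "(\<lambda>n. real (n div 2) / real n) \<longlonglongrightarrow> 1 / 2"
  by (rule ratio_tendsto_half) linarith

text \<open>Overwriting one value by 0 changes the sum by at most its modulus. This absorbs the zero
  inserted into the spectrum of W, as the cosine formula at n div 2 tends to 2 cos (pi / 2) =
  0.\<close>

lemma sum_fun_upd_tendsto: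
  fixes f g :: "nat \<Rightarrow> nat \<Rightarrow> real"
  assumes lim: "(\<lambda>n. \<Sum>k = 1..h n. \<bar>f n k - g n k\<bar>) \<longlonglongrightarrow> s" and f: "(\<lambda>n. f n (h n)) \<longlonglongrightarrow> 0"
  shows "(\<lambda>n. \<Sum>k = 1..h n. \<bar>((f n)(h n := 0)) k - g n k\<bar>) \<longlonglongrightarrow> s"
proof -
  have "\<bar>(\<Sum>k = 1..h n. \<bar>((f n)(h n := 0)) k - g n k\<bar>) - (\<Sum>k = 1..h n. \<bar>f n k - g n k\<bar>)\<bar> \<le> \<bar>f n (h n)\<bar>" for n
  proof (cases "h n")
    case (Suc m)
    have "(\<Sum>k = 1..m. \<bar>((f n)(Suc m := 0)) k - g n k\<bar>) = (\<Sum>k = 1..m. \<bar>f n k - g n k\<bar>)"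
      by (intro sum.cong) auto
    thus ?thesis
      unfolding Suc by simp
  qed simp
  hence "(\<lambda>n. (\<Sum>k = 1..h n. \<bar>((f n)(h n := 0)) k - g n k\<bar>) - (\<Sum>k = 1..h n. \<bar>f n k - g n k\<bar>)) \<longlonglongrightarrow> 0"
    by (intro Lim_null_comparison[OF _ tendsto_rabs_zero[OF f]]) simp
  from tendsto_add[OF this lim] show ?thesis by simp
qed

section \<open>The four limits\<close>

lemma path_Z_limit:
  "(\<lambda>n. spectral_distance (path_graph n) (Z_graph n)) \<longlonglongrightarrow> (8 - 8 * sqrt 2 + 2 * pi) / pi"
proof -
  have "(\<lambda>n. 2 * (\<Sum>k = 1..n div 2. \<bar>shifted_cos 0 1 n k - shifted_cos (-1/2) (-1) n k\<bar>)) \<longlonglongrightarrow>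
      2 * ((4 - 4 * sqrt 2 + pi) / pi)"
    using sum_shifted_cos_tendsto[OF _ half_ratio_tendsto, of 0 1 "-1/2" "-1"]
    by (intro tendsto_mult_left) (simp flip: integral_sin_abs_quarter)
  moreover have "\<forall>\<^sub>F n in sequentially. spectral_distance (path_graph n) (Z_graph n) =
      2 * (\<Sum>k = 1..n div 2. \<bar>shifted_cos 0 1 n k - shifted_cos (-1/2) (-1) n k\<bar>)"
    using eventually_ge_at_top[of 3]
    by eventually_elim (rule spectral_distance_half_spectrum[OF has_half_spectrum_path has_half_spectrum_Z])
  ultimately show ?thesis
    by (simp add: tendsto_cong algebra_simps)
qed

lemma shifted_cos_half_tendsto: "(\<lambda>n. shifted_cos c d n (n div 2)) \<longlonglongrightarrow> 0"
  using shifted_cos_tendsto[OF half_ratio_tendsto, of c d] by simp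

lemma W_Z_limit:
  "(\<lambda>n. spectral_distance (W_graph n) (Z_graph n)) \<longlonglongrightarrow> (8 - 8 * sqrt 2 + 2 * pi) / pi"
proof -
  let ?w = "\<lambda>n. (shifted_cos (-1) (-3) n)(n div 2 := 0)"
  \<comment> \<open>The shifts differ by -1/2 and -2, the negatives of the differences for P and
    Z.\<close>
  have eq: "\<bar>- 1 - - 1/2 - (- 3 - - 1) * x\<bar> = \<bar>1/2 - 2 * x\<bar>" for x :: real
  proof -
    have "- 1 - - 1/2 - (- 3 - - 1) * x = - (1/2 - 2 * x)"
      by simp
    thus ?thesis
      by (simp only: abs_minus_cancel)
  qed
  have "(\<lambda>n. \<Sum>k = 1..n div 2. \<bar>shifted_cos (-1) (-3) n k - shifted_cos (-1/2) (-1) n k\<bar>) \<longlonglongrightarrow>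
      (4 - 4 * sqrt 2 + pi) / pi"
    using sum_shifted_cos_tendsto[OF _ half_ratio_tendsto, of "-1" "-3" "-1/2" "-1"]
    unfolding eq integral_sin_abs_quarter by simp
  from sum_fun_upd_tendsto[OF this shifted_cos_half_tendsto]
  have "(\<lambda>n. 2 * (\<Sum>k = 1..n div 2. \<bar>?w n k - shifted_cos (-1/2) (-1) n k\<bar>)) \<longlonglongrightarrow>
      2 * ((4 - 4 * sqrt 2 + pi) / pi)"
    by (rule tendsto_mult_left)
  moreover have "\<forall>\<^sub>F n in sequentially. spectral_distance (W_graph n) (Z_graph n) =
      2 * (\<Sum>k = 1..n div 2. \<bar>?w n k - shifted_cos (-1/2) (-1) n k\<bar>)"
    using eventually_ge_at_top[of 6]
    by eventually_elim (rule spectral_distance_half_spectrum[OF has_half_spectrum_W has_half_spectrum_Z], auto)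
  ultimately show ?thesis
    by (simp add: tendsto_cong algebra_simps)
qed

lemma path_W_limit:
  "(\<lambda>n. spectral_distance (path_graph n) (W_graph n)) \<longlonglongrightarrow> 2 * ((8 - 8 * sqrt 2 + 2 * pi) / pi)"
proof -
  let ?w = "\<lambda>n. (shifted_cos (-1) (-3) n)(n div 2 := 0)"
  \<comment> \<open>The shifts differ by -1 and -4, up to sign twice the differences for P and
    Z.\<close>
  have eq: "2 * pi * (sin (pi * x) * \<bar>- 1 - 0 - (- 3 - 1) * x\<bar>) =
      2 * (2 * pi * (sin (pi * x) * \<bar>1/2 - 2 * x\<bar>))" for x :: real
  proof -
    have "- 1 - 0 - (- 3 - 1) * x = - (2 * (1/2 - 2 * x))"
      by simp
    thus ?thesis
      by (simp only: abs_minus_cancel abs_mult abs_numeral mult.left_commute)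
  qed
  let ?g = "\<lambda>x. 2 * pi * (sin (pi * x) * \<bar>1/2 - 2 * x\<bar>)"
  have int: "integral {0..1/2} (\<lambda>x. 2 * ?g x) = 2 * ((4 - 4 * sqrt 2 + pi) / pi)"
    unfolding integral_mult_right[of _ 2 ?g] integral_sin_abs_quarter ..
  have "(\<lambda>n. \<Sum>k = 1..n div 2. \<bar>shifted_cos (-1) (-3) n k - shifted_cos 0 1 n k\<bar>) \<longlonglongrightarrow>
      2 * ((4 - 4 * sqrt 2 + pi) / pi)"
    using sum_shifted_cos_tendsto[OF _ half_ratio_tendsto, of "-1" "-3" 0 1]
    unfolding eq int by simp
  from sum_fun_upd_tendsto[OF this shifted_cos_half_tendsto]
  have "(\<lambda>n. 2 * (\<Sum>k = 1..n div 2. \<bar>?w n k - shifted_cos 0 1 n k\<bar>)) \<longlonglongrightarrow>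
      2 * (2 * ((4 - 4 * sqrt 2 + pi) / pi))"
    by (rule tendsto_mult_left)
  moreover have "\<forall>\<^sub>F n in sequentially. spectral_distance (path_graph n) (W_graph n) =
      2 * (\<Sum>k = 1..n div 2. \<bar>?w n k - shifted_cos 0 1 n k\<bar>)"
    using eventually_ge_at_top[of 6]
  proof eventually_elim
    case (elim n)
    show ?case
      unfolding spectral_distance_half_spectrum[OF has_half_spectrum_path has_half_spectrum_W[OF elim]]
      by (simp only: abs_minus_commute)
  qed
  ultimately show ?thesis
    by (simp add: tendsto_cong algebra_simps)
qed

text \<open>Index 1 is set apart so that both sums over j start at 1, as in
  \<open>sum_shifted_cos_tendsto\<close>.\<close>

lemma sum_even_odd_split:
  fixes g :: "nat \<Rightarrow> 'a :: comm_monoid_add"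
  shows "(\<Sum>k = 1..Suc m. g k) =
    g 1 + (\<Sum>j = 1..Suc m div 2. g (2 * j)) + (\<Sum>j = 1..m div 2. g (Suc (2 * j)))"
proof (induction m)
  case (Suc m)
  show ?case
  proof (cases "even m")
    case True
    hence "Suc (Suc m) div 2 = Suc (m div 2)" "Suc m div 2 = m div 2" "2 * Suc (m div 2) = Suc (Suc m)"
      by auto
    thus ?thesis
      using Suc by (simp add: add_ac)
  next
    case False
    hence "Suc (Suc m) div 2 = Suc m div 2" "Suc m div 2 = Suc (m div 2)" "Suc (2 * Suc (m div 2)) = Suc (Suc m)"
      by (auto elim!: oddE)
    thus ?thesis
      using Suc by (simp add: add_ac)
  qed
qed simp

text \<open>For k = 2 j or k = 2 j + 1, halving numerator and denominator of (k - 1/2) / (2 m - 1)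
  gives j - 1/4 or j + 1/4 over m - 1/2. Both families thus become \<open>shifted_cos\<close>
  sequences in m, comparable with the cycle's value at j.\<close>

lemma cycle_Z_limit:
  "(\<lambda>m. spectral_distance (cycle_graph (2 * m)) (Z_graph (2 * m))) \<longlonglongrightarrow> 2"
proof -
  \<comment> \<open>The term k = 1, that is j = 0; both eigenvalues tend to 2.\<close>
  let ?a = "\<lambda>m. \<bar>shifted_cos 0 0 m 0 - shifted_cos (1/4) (-1/2) m 0\<bar>"
  let ?e = "\<lambda>m. \<Sum>j = 1..m div 2. \<bar>shifted_cos 0 0 m j - shifted_cos (-1/4) (-1/2) m j\<bar>"
  let ?o = "\<lambda>m. \<Sum>j = 1..(m - 1) div 2. \<bar>shifted_cos 0 0 m j - shifted_cos (1/4) (-1/2) m j\<bar>"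
  let ?ie = "integral {0..1/2} (\<lambda>x. 2 * pi * (sin (pi * x) * \<bar>1/4 - 1/2 * x\<bar>))"
  let ?io = "integral {0..1/2} (\<lambda>x. 2 * pi * (sin (pi * x) * \<bar>- 1/4 - 1/2 * x\<bar>))"
  have a: "?a \<longlonglongrightarrow> \<bar>2 * cos (pi * 0) - 2 * cos (pi * 0)\<bar>"
    by (intro tendsto_intros shifted_cos_tendsto)
  have e: "?e \<longlonglongrightarrow> ?ie"
    using sum_shifted_cos_tendsto[OF _ half_ratio_tendsto, of 0 0 "-1/4" "-1/2"] by simp
  have "(\<lambda>m. real ((m - 1) div 2) / real m) \<longlonglongrightarrow> 1 / 2"
    by (rule ratio_tendsto_half) linarith
  from sum_shifted_cos_tendsto[OF _ this, of 0 0 "1/4" "-1/2"] have o: "?o \<longlonglongrightarrow> ?io"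
    by simp
  have "(\<lambda>m. 2 * (?a m + ?e m + ?o m)) \<longlonglongrightarrow> 2 * (\<bar>2 * cos (pi * 0) - 2 * cos (pi * 0)\<bar> + ?ie + ?io)"
    by (intro tendsto_mult_left tendsto_add a e o)
  also have "2 * (\<bar>2 * cos (pi * 0) - 2 * cos (pi * 0)\<bar> + ?ie + ?io) = 2"
    using integral_sin_abs_even_odd by simp
  finally have "(\<lambda>m. 2 * (?a m + ?e m + ?o m)) \<longlonglongrightarrow> 2" .
  moreover have "\<forall>\<^sub>F m in sequentially. spectral_distance (cycle_graph (2 * m)) (Z_graph (2 * m)) =
      2 * (?a m + ?e m + ?o m)"
    using eventually_ge_at_top[of 2]
  proof eventually_elim
    case (elim m)
    let ?g = "\<lambda>k. \<bar>shifted_cos 0 0 m (k div 2) - shifted_cos (-1/2) (-1) (2 * m) k\<bar>"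
    have double: "shifted_cos (2 * c) (2 * d) (2 * m) (2 * j) = shifted_cos c d m j" for c d j
    proof -
      have "real (2 * j) + 2 * c = 2 * (real j + c)" "real (2 * m) + 2 * d = 2 * (real m + d)"
        by simp_all
      thus ?thesis
        unfolding shifted_cos_def by (simp only: mult_divide_mult_cancel_left)
    qed
    have even: "?g (2 * j) = \<bar>shifted_cos 0 0 m j - shifted_cos (-1/4) (-1/2) m j\<bar>" for j
      using double[of "-1/4" "-1/2" j] by simp
    have odd: "?g (Suc (2 * j)) = \<bar>shifted_cos 0 0 m j - shifted_cos (1/4) (-1/2) m j\<bar>" for j
    proof -
      have "shifted_cos (-1/2) (-1) (2 * m) (Suc (2 * j)) = shifted_cos (1/2) (-1) (2 * m) (2 * j)"
        by (simp add: shifted_cos_def add.commute)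
      thus ?thesis
        using double[of "1/4" "-1/2" j] by simp
    qed
    obtain m' where m': "m = Suc m'"
      using elim by (cases m) auto
    have "spectral_distance (cycle_graph (2 * m)) (Z_graph (2 * m)) = 2 * (\<Sum>k = 1..2 * m div 2. ?g k)"
      by (rule spectral_distance_half_spectrum[OF has_half_spectrum_cycle has_half_spectrum_Z])
         (use elim in auto)
    also have "(\<Sum>k = 1..2 * m div 2. ?g k) = ?g 1 + (\<Sum>j = 1..m div 2. ?g (2 * j)) + (\<Sum>j = 1..(m - 1) div 2. ?g (Suc (2 * j)))"
      using sum_even_odd_split[of ?g m'] by (simp add: m')
    also have "?g 1 = ?a m"
      using odd[of 0] by simp
    finally show ?case
      unfolding even odd .
  qed
  ultimately show ?thesis
    by (simp add: tendsto_cong)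
qed

text \<open>A \<open>lim\<close> is informative only for convergent sequences, so convergence for P
  and W, which the first three claims do not cover, is asserted separately. The bound 0.0005
  expresses rounding to three decimals.\<close>

theorem theorem1p1:
  "((\<lambda>n. spectral_distance (cycle_graph (2 * n)) (Z_graph (2 * n))) \<longlonglongrightarrow> 2) \<and>
   ((\<lambda>n. spectral_distance (path_graph n) (Z_graph n)) \<longlonglongrightarrow> (8 - 8 * sqrt 2 + 2 * pi) / pi) \<and>
   ((\<lambda>n. spectral_distance (W_graph n) (Z_graph n)) \<longlonglongrightarrow> (8 - 8 * sqrt 2 + 2 * pi) / pi) \<and>
   (convergent (\<lambda>n. spectral_distance (path_graph n) (W_graph n)) \<and>
    lim (\<lambda>n. spectral_distance (path_graph n) (Z_graph n)) =
      lim (\<lambda>n. spectral_distance (W_graph n) (Z_graph n)) \<and>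
    lim (\<lambda>n. spectral_distance (W_graph n) (Z_graph n)) =
      1 / 2 * lim (\<lambda>n. spectral_distance (path_graph n) (W_graph n)) \<and>
    1 / 2 * lim (\<lambda>n. spectral_distance (path_graph n) (W_graph n)) =
      (8 - 8 * sqrt 2 + 2 * pi) / pi) \<and>
   \<bar>(8 - 8 * sqrt 2 + 2 * pi) / pi - 0.945\<bar> < 0.0005"
proof -
  have half: "1 / 2 * (2 * c) = c" for c :: real
    by simp
  show ?thesis
    unfolding limI[OF path_Z_limit] limI[OF W_Z_limit] limI[OF path_W_limit] half
    using cycle_Z_limit path_Z_limit W_Z_limit convergentI[OF path_W_limit] limit_value_approx
    by blast
qed

end
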